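(* Let $\{S_i\}_{i=1}^m$ be an SS-IFS in $\mathbb{R}^d$ with attractor $K$ containing at least two points and transformation group $\mathcal{T}$, let $t=\dim_H(K)$, let $U\subseteq\mathbb{R}^d$ be an open neighbourhood of $K$, and assume that, for some $1\le l<d$, there exists $M\in G_{d,l}$ such that the set $\{O(M):O\in\mathcal{T}\}$ is dense in $G_{d,l}$. Then $\mathcal{H}^t(g(K))=0$ for every continuously differentiable map $g:U\to\mathbb{R}^{d_2}$ such that $\mathrm{rank}(g'(x))\le l$ for every $x\in K$.
   Context: $\dim_H$ denotes Hausdorff dimension and $\mathcal{H}^t$ denotes $t$-dimensional Hausdorff measure. $G_{d,l}$ is the Grassmann manifold of $l$-dimensional linear subspaces of $\mathbb{R}^d$ with its usual topology (e.g. from the metric $\|\Pi_M-\Pi_N\|$, where $\Pi_M$ is orthogonal projection onto $M$). A self-similar iterated function system (SS-IFS) in $\mathbb{R}^d$ is a finite collection $\{S_i\}_{i=1}^m$ of contracting similarities of $\mathbb{R}^d$, written uniquely as $S_i(x)=r_iT_i(x)+v_i$ with $0<r_i<1$, $T_i$ an orthogonal transformation of $\mathbb{R}^d$ and $v_i\in\mathbb{R}^d$. Its attractor is the unique nonempty compact $K$ with $K=\bigcup_{i=1}^m S_i(K)$. Its transformation group $\mathcal{T}$ is the group generated by $T_1,\ldots,T_m$. No separation condition is assumed. *)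

theory Defs
  imports "HOL-Analysis.Analysis" "HOL-Algebra.Generated_Groups" "HOL-Algebra.Bij"
begin

section \<open>Hausdorff measure and Hausdorff dimension\<close>

text \<open>
  The term contributed by a covering set \<open>V\<close> is \<open>\<bar>V\<bar>\<^sup>t\<close>, with the usual conventions
  \<open>\<bar>{}\<bar>\<^sup>t = 0\<close> for all \<open>t\<close> and \<open>\<bar>V\<bar>\<^sup>0 = 1\<close> for \<open>V \<noteq> {}\<close>, so that the measure for
  \<open>t = 0\<close> is the counting measure. The case \<open>t = 0\<close> is separate because \<open>0 powr 0 = 0\<close>.
\<close>

definition diameter_power :: "real \<Rightarrow> 'a::metric_space set \<Rightarrow> ennreal" where
  "diameter_power t V =
     (if V = {} then 0 else if t = 0 then 1 else ennreal (diameter V powr t))"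

text \<open>
  Boundedness is required explicitly because \<^term>\<open>diameter V\<close> is a real number, which is
  meaningless for unbounded \<open>V\<close>. Finite covers are included, since some \<open>V i\<close> may be empty.
\<close>

definition delta_covers :: "real \<Rightarrow> 'a::metric_space set \<Rightarrow> (nat \<Rightarrow> 'a set) set" where
  "delta_covers \<delta> E =
     {V. E \<subseteq> (\<Union>i. V i) \<and> (\<forall>i. bounded (V i) \<and> diameter (V i) \<le> \<delta>)}"

definition hausdorff_premeasure :: "real \<Rightarrow> real \<Rightarrow> 'a::metric_space set \<Rightarrow> ennreal" where
  "hausdorff_premeasure t \<delta> E = (INF V\<in>delta_covers \<delta> E. \<Sum>i. diameter_power t (V i))"

text \<open>The supremum is the limit as \<open>\<delta>\<close> tends to \<open>0\<close>, by monotonicity in \<open>\<delta>\<close>.\<close>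

definition hausdorff_measure :: "real \<Rightarrow> 'a::metric_space set \<Rightarrow> ennreal" where
  "hausdorff_measure t E = (SUP \<delta>\<in>{0<..}. hausdorff_premeasure t \<delta> E)"

text \<open>
  The type is restricted to Euclidean spaces, where the infimum is over a nonempty set of reals.
\<close>

definition hausdorff_dim :: "'a::euclidean_space set \<Rightarrow> real" where
  "hausdorff_dim E = Inf {t. 0 \<le> t \<and> hausdorff_measure t E = 0}"


section \<open>The Grassmannian\<close>

definition grassmannian :: "nat \<Rightarrow> 'a::euclidean_space set set" where
  "grassmannian l = {M. subspace M \<and> dim M = l}"

definition orthogonal_projection :: "'a::euclidean_space set \<Rightarrow> 'a \<Rightarrow> 'a" where
  "orthogonal_projection M x = (THE y. y \<in> M \<and> (\<forall>z\<in>M. orthogonal (x - y) z))"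

lemma orthogonal_projection_eqI:
  assumes "subspace M" "y \<in> M" "\<And>z. z \<in> M \<Longrightarrow> orthogonal (x - y) z"
  shows "orthogonal_projection M x = y"
  unfolding orthogonal_projection_def
proof (rule the_equality)
  fix y' assume y': "y' \<in> M \<and> (\<forall>z\<in>M. orthogonal (x - y') z)"
  have "y - y' \<in> M"
    using assms y' by (simp add: subspace_diff)
  then have "(x - y') \<bullet> (y - y') = 0" "(x - y) \<bullet> (y - y') = 0"
    using assms(3) y' by (auto simp: orthogonal_def)
  then have "(y - y') \<bullet> (y - y') = 0"
    by (simp add: inner_diff_left)
  then show "y' = y" by simp
qed (use assms in auto)

lemma orthogonal_projection:
  assumes "subspace M"
  shows "orthogonal_projection M x \<in> M"
    and "z \<in> M \<Longrightarrow> orthogonal (x - orthogonal_projection M x) z"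
proof -
  obtain y w where yw: "y \<in> span M" "\<And>z. z \<in> span M \<Longrightarrow> orthogonal w z" "x = y + w"
    using orthogonal_subspace_decomp_exists[of M x] by metis
  have sp: "span M = M"
    using assms by (simp add: span_eq_iff)
  have "orthogonal_projection M x = y"
    by (rule orthogonal_projection_eqI) (use assms yw sp in auto)
  with yw sp show "orthogonal_projection M x \<in> M"
    and "z \<in> M \<Longrightarrow> orthogonal (x - orthogonal_projection M x) z"
    by auto
qed

lemma bounded_linear_orthogonal_projection:
  assumes "subspace M"
  shows "bounded_linear (orthogonal_projection M)"
proof -
  have mem: "orthogonal_projection M x \<in> M" for x
    by (rule orthogonal_projection(1)[OF assms])
  have inner: "orthogonal_projection M x \<bullet> z = x \<bullet> z" if "z \<in> M" for x z
    using orthogonal_projection(2)[OF assms that, of x]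
    by (simp add: orthogonal_def inner_diff_left)
  have "linear (orthogonal_projection M)"
  proof (rule linearI)
    fix x y
    show "orthogonal_projection M (x + y) = orthogonal_projection M x + orthogonal_projection M y"
      by (rule orthogonal_projection_eqI)
        (simp_all add: assms mem inner subspace_add orthogonal_def inner_diff_left inner_add_left)
  next
    fix c x
    show "orthogonal_projection M (c *\<^sub>R x) = c *\<^sub>R orthogonal_projection M x"
      by (rule orthogonal_projection_eqI)
        (simp_all add: assms mem inner subspace_scale orthogonal_def inner_diff_left)
  qed
  then show ?thesis
    by (simp add: linear_conv_bounded_linear)
qed

text \<open>The operator norm of the difference of the orthogonal projections.\<close>

definition grassmann_dist :: "'a::euclidean_space set \<Rightarrow> 'a set \<Rightarrow> real" where
  "grassmann_dist M N =
     norm (Blinfun (orthogonal_projection M) - Blinfun (orthogonal_projection N))"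

lemma Metric_space_grassmannian:
  "Metric_space (grassmannian l :: 'a::euclidean_space set set) grassmann_dist"
proof
  fix M N :: "'a set"
  assume "M \<in> grassmannian l" "N \<in> grassmannian l"
  then have sub: "subspace M" "subspace N"
    by (auto simp: grassmannian_def)
  have range: "range (orthogonal_projection L) = L" if "subspace L" for L :: "'a set"
  proof
    show "range (orthogonal_projection L) \<subseteq> L"
      using orthogonal_projection(1)[OF that] by auto
    have "orthogonal_projection L x = x" if "x \<in> L" for x
      by (rule orthogonal_projection_eqI)
        (use \<open>subspace L\<close> that in \<open>auto simp: orthogonal_def\<close>)
    then show "L \<subseteq> range (orthogonal_projection L)"
      by (metis rangeI subsetI)
  qed
  show "grassmann_dist M N = 0 \<longleftrightarrow> M = N"
  proof
    assume "grassmann_dist M N = 0"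
    then have "Blinfun (orthogonal_projection M) = Blinfun (orthogonal_projection N)"
      by (simp add: grassmann_dist_def)
    then have "orthogonal_projection M = orthogonal_projection N"
      using sub by (metis bounded_linear_Blinfun_apply bounded_linear_orthogonal_projection)
    then show "M = N"
      using range sub by metis
  qed (simp add: grassmann_dist_def)
next
  fix M N L :: "'a set"
  show "grassmann_dist M L \<le> grassmann_dist M N + grassmann_dist N L"
    unfolding grassmann_dist_def
    using norm_triangle_ineq[of "Blinfun (orthogonal_projection M) - Blinfun (orthogonal_projection N)" "Blinfun (orthogonal_projection N) - Blinfun (orthogonal_projection L)"]
    by simp
next
  fix M N :: "'a set"
  show "0 \<le> grassmann_dist M N"
    unfolding grassmann_dist_def by (rule norm_ge_zero)
  show "grassmann_dist M N = grassmann_dist N M"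
    unfolding grassmann_dist_def by (rule norm_minus_commute)
qed

definition grassmann_topology :: "nat \<Rightarrow> 'a::euclidean_space set topology" where
  "grassmann_topology l = Metric_space.mtopology (grassmannian l) grassmann_dist"


section \<open>Self-similar iterated function systems\<close>

definition ss_ifs ::
  "nat \<Rightarrow> (nat \<Rightarrow> 'a::euclidean_space \<Rightarrow> 'a) \<Rightarrow> (nat \<Rightarrow> real) \<Rightarrow> (nat \<Rightarrow> 'a \<Rightarrow> 'a) \<Rightarrow> (nat \<Rightarrow> 'a) \<Rightarrow> bool"
  where
  "ss_ifs m S r T v \<longleftrightarrow>
     (\<forall>i\<in>{1..m}. 0 < r i \<and> r i < 1 \<and> orthogonal_transformation (T i) \<and>
                 (\<forall>x. S i x = r i *\<^sub>R T i x + v i))"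

definition ifs_attractor ::
  "nat \<Rightarrow> (nat \<Rightarrow> 'a::euclidean_space \<Rightarrow> 'a) \<Rightarrow> 'a set \<Rightarrow> bool" where
  "ifs_attractor m S K \<longleftrightarrow> K \<noteq> {} \<and> compact K \<and> K = (\<Union>i\<in>{1..m}. S i ` K)"

text \<open>
  The subgroup generated by \<open>T\<^sub>1, \<dots>, T\<^sub>m\<close>, taken inside the group of all bijections of the space.
\<close>

definition transformation_group ::
  "nat \<Rightarrow> (nat \<Rightarrow> 'a::euclidean_space \<Rightarrow> 'a) \<Rightarrow> ('a \<Rightarrow> 'a) set" where
  "transformation_group m T = generate (BijGroup UNIV) (T ` {1..m})"

end

theory Submission
  imports Defs
begin

text \<open>
  Write \<open>t\<close> for the dimension of \<open>K\<close> and \<open>r\<^sub>w\<close> for the ratio of the cylinder of a word \<open>w\<close>. If finitely many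
  cylinders are pairwise disjoint, then \<open>\<Sum> r\<^sub>w\<^sup>t \<le> 1\<close>: otherwise they generate a self-similar subset with
  strong separation, of dimension greater than \<open>t\<close>. This bound takes over the role of the measure of \<open>K\<close>.

  Starting from a single cylinder, one obtains \<open>2\<^sup>n\<close> disjoint cylinders of equal ratio whose
  projections to some \<open>l\<close>-plane nearly coincide: take two disjoint cylinders with
  nearly equal rotations, put a rotated copy of the previous cluster into both, and project along the vector that
  joins them. As the rotations act densely and \<open>g'\<close> factors through an \<open>l\<close>-plane, every small cylinder contains,
  at a relative size depending only on \<open>n\<close>, such a cluster that \<open>g\<close> maps into a single set of comparable diameter.
  Covering \<open>g(K)\<close> by the images of clusters therefore costs \<open>O(2\<^sup>-\<^sup>n)\<close>, and what the clusters miss can be made to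
  cost arbitrarily little.
\<close>

text \<open>Overlaps may make the t-dimensional Hausdorff measure of K zero, so no measure giving
  cylinders mass comparable to r_w^t is at hand. The bound on disjoint families replaces it, but
  such a family need not cover K; a maximal one does so once each cylinder is enlarged in proportion
  to its ratio (\<open>near\<close>).

  The order of the constants decides the argument. A cluster of 2^n cylinders of common ratio s has
  content 2^n s^t, while its image lies in one set of diameter at most C s with C independent of n,
  so the quotient of cost by content is C^t / 2^n. The relative size of clusters deteriorates with
  n, but this affects the number of stages needed to exhaust the content, not the cost.

  Density is assumed for the group generated by the T_i, whereas cylinders realise products of the
  T_i without inverses. Recurrence closes the gap: some positive power of an orthogonal map is close
  to the identity, so the preceding power is close to the inverse. The hypothesis l < d provides an
  l-plane orthogonal to any prescribed vector.\<close>

section \<open>Hausdorff measure and finite covers\<close>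

lemma hausdorff_measure_eq_0I:
  fixes E :: "'a::metric_space set"
  assumes "0 < t"
    and cover: "\<And>\<delta> \<epsilon>. 0 < \<delta> \<Longrightarrow> 0 < \<epsilon> \<Longrightarrow> \<exists>(I::'i set) V b. finite I \<and> E \<subseteq> (\<Union>i\<in>I. V i) \<and>
      (\<forall>i\<in>I. 0 \<le> b i \<and> b i \<le> \<delta> \<and> (\<forall>x\<in>V i. \<forall>y\<in>V i. dist x y \<le> b i)) \<and>
      (\<Sum>i\<in>I. b i powr t) \<le> \<epsilon>"
  shows "hausdorff_measure t E = 0"
proof -
  have "hausdorff_premeasure t \<delta> E \<le> ennreal \<epsilon>" if pos: "0 < \<delta>" "0 < \<epsilon>" for \<delta> \<epsilon>
  proof -
    obtain I :: "'i set" and V b where fin: "finite I" and E: "E \<subseteq> (\<Union>i\<in>I. V i)"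
      and b: "\<And>i. i \<in> I \<Longrightarrow> 0 \<le> b i \<and> b i \<le> \<delta>"
      and dist: "\<And>i x y. i \<in> I \<Longrightarrow> x \<in> V i \<Longrightarrow> y \<in> V i \<Longrightarrow> dist x y \<le> b i"
      and sum: "(\<Sum>i\<in>I. b i powr t) \<le> \<epsilon>"
      using cover[OF pos] by (elim exE conjE) blast
    obtain h where h: "bij_betw h {..<card I} I"
      using fin ex_bij_betw_nat_finite[of I] by (auto simp: lessThan_atLeast0)
    define V' where "V' k = (if k < card I then V (h k) else {})" for k
    have bd: "bounded (V i) \<and> diameter (V i) \<le> b i" if "i \<in> I" for i
    proof
      show "bounded (V i)"
        using dist[OF that] unfolding bounded_def by (metis dist_commute ex_in_conv)
      show "diameter (V i) \<le> b i"
        unfolding diameter_def using dist[OF that] b[OF that] by (auto intro!: cSUP_least)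
    qed
    have hI: "h k \<in> I" if "k < card I" for k
      using h that by (auto simp: bij_betw_def)
    have "V' \<in> delta_covers \<delta> E"
      unfolding delta_covers_def mem_Collect_eq
    proof safe
      fix x assume "x \<in> E"
      then obtain i where "i \<in> I" "x \<in> V i" using E by auto
      then obtain k where "k < card I" "h k = i"
        using bij_betw_imp_surj_on[OF h] by (metis imageE lessThan_iff)
      then show "x \<in> (\<Union>k. V' k)" using \<open>x \<in> V i\<close> by (auto simp: V'_def)
    next
      fix k
      show "bounded (V' k)" "diameter (V' k) \<le> \<delta>"
        using bd[OF hI] b[OF hI] pos by (fastforce simp: V'_def)+
    qed
    then have "hausdorff_premeasure t \<delta> E \<le> (\<Sum>k. diameter_power t (V' k))"
      unfolding hausdorff_premeasure_def by (rule INF_lower)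
    also have "\<dots> = (\<Sum>k<card I. diameter_power t (V' k))"
      by (rule suminf_finite) (auto simp: V'_def diameter_power_def)
    also have "\<dots> \<le> (\<Sum>k<card I. ennreal (b (h k) powr t))"
    proof (rule sum_mono)
      fix k assume k: "k \<in> {..<card I}"
      then have "diameter (V (h k)) powr t \<le> b (h k) powr t"
        using bd[OF hI[of k]] \<open>0 < t\<close> by (intro powr_mono2) (auto simp: diameter_ge_0)
      then show "diameter_power t (V' k) \<le> ennreal (b (h k) powr t)"
        using k \<open>0 < t\<close> by (auto simp: V'_def diameter_power_def intro: ennreal_leI)
    qed
    also have "\<dots> = ennreal (\<Sum>k<card I. b (h k) powr t)"
      by (simp add: sum_ennreal)
    also have "(\<Sum>k<card I. b (h k) powr t) = (\<Sum>i\<in>I. b i powr t)"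
      using h by (rule sum.reindex_bij_betw)
    also have "ennreal \<dots> \<le> ennreal \<epsilon>" using sum by (rule ennreal_leI)
    finally show ?thesis .
  qed
  then have "hausdorff_premeasure t \<delta> E = 0" if "0 < \<delta>" for \<delta>
    using that by (metis ennreal_le_epsilon add_0 le_zero_eq ennreal_0)
  then show ?thesis by (simp add: hausdorff_measure_def)
qed

text \<open>Each covering set is fattened to an open one, at an extra cost that is summable in the
  index, and compactness leaves finitely many. The fattening also makes the bounds \<open>b\<close>
  positive for one-point sets.\<close>

lemma hausdorff_null_finite_cover:
  fixes K :: "'a::metric_space set"
  assumes "compact K" "K \<noteq> {}" "0 \<le> s" "hausdorff_measure s K = 0" "0 < \<eta>"
  shows "\<exists>(J::nat set) W b. finite J \<and> K \<subseteq> (\<Union>j\<in>J. W j) \<and>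
    (\<forall>j\<in>J. 0 < b j \<and> (\<forall>x\<in>W j. \<forall>y\<in>W j. dist x y \<le> b j)) \<and> (\<Sum>j\<in>J. b j powr s) < \<eta>"
proof -
  \<comment> \<open>\<open>e \<le> 1\<close> excludes s = 0, where a nonempty set costs at least 1;
    the fattened cover will cost at most \<open>2 * e\<close>, which is below \<eta>.\<close>
  define e where "e = min 1 (\<eta> / 4)"
  have e: "0 < e" "e \<le> 1" "e \<le> \<eta> / 4" using \<open>0 < \<eta>\<close> by (auto simp: e_def)
  have "hausdorff_premeasure s 1 K \<le> hausdorff_measure s K"
    unfolding hausdorff_measure_def by (rule SUP_upper) simp
  then have "hausdorff_premeasure s 1 K < ennreal e"
    using assms e by simp
  then obtain V where V: "V \<in> delta_covers 1 K" and sumV: "(\<Sum>i. diameter_power s (V i)) < ennreal e"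
    unfolding hausdorff_premeasure_def INF_less_iff by auto
  have cov: "K \<subseteq> (\<Union>i. V i)" and bdd: "bounded (V i)" for i
    using V by (auto simp: delta_covers_def)
  have "s \<noteq> 0"
  proof
    assume "s = 0"
    obtain i where "V i \<noteq> {}" using cov \<open>K \<noteq> {}\<close> by blast
    then have "1 \<le> diameter_power s (V i)" using \<open>s = 0\<close> by (simp add: diameter_power_def)
    also have "\<dots> \<le> (\<Sum>i. diameter_power s (V i))"
      using sum_le_suminf[of "\<lambda>i. diameter_power s (V i)" "{i}"] by simp
    finally have "1 < ennreal e" using sumV by (rule le_less_trans)
    then show False using e(2) by (simp add: ennreal_less_iff flip: ennreal_1)
  qed
  then have "0 < s" using \<open>0 \<le> s\<close> by simp
  \<comment> \<open>\<open>V i\<close> may have diameter 0, where continuity of the power from the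
    right rests on 0 < s.\<close>
  have "\<exists>c>0. (diameter (V i) + c) powr s \<le> diameter (V i) powr s + e * (1/2) ^ Suc i" for i
  proof -
    have "((\<lambda>c. (diameter (V i) + c) powr s) \<longlongrightarrow> (diameter (V i) + 0) powr s) (at_right 0)"
    proof (rule tendsto_powr')
      show "((\<lambda>c. diameter (V i) + c) \<longlongrightarrow> diameter (V i) + 0) (at_right 0)"
        by (intro tendsto_intros)
      show "diameter (V i) + 0 \<noteq> 0 \<or> 0 < s \<and> (\<forall>\<^sub>F x in at_right 0. 0 \<le> diameter (V i) + x)"
        using \<open>0 < s\<close> diameter_ge_0[OF bdd, of i]
        by (auto intro!: eventually_at_rightI[of 0 1])
    qed simp
    then have "\<forall>\<^sub>F c in at_right 0. (diameter (V i) + c) powr s < diameter (V i) powr s + e * (1/2) ^ Suc i"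
      by (rule order_tendstoD) (use e in simp)
    then have "\<forall>\<^sub>F c in at_right 0. c > 0 \<and> (diameter (V i) + c) powr s < diameter (V i) powr s + e * (1/2) ^ Suc i"
      by (intro eventually_conj eventually_at_right_less)
    then show ?thesis
      using eventually_happens'[of "at_right (0::real)"] by (fastforce simp: less_imp_le)
  qed
  then obtain c where c: "\<And>i. 0 < c i"
    "\<And>i. (diameter (V i) + c i) powr s \<le> diameter (V i) powr s + e * (1/2) ^ Suc i"
    by metis
  define W where "W i = (\<Union>x\<in>V i. ball x (c i / 2))" for i
  have "open (W i)" for i by (auto simp: W_def)
  moreover have "K \<subseteq> (\<Union>i\<in>UNIV. W i)"
    using cov c(1) by (force simp: W_def)
  ultimately obtain J where J: "finite J" "K \<subseteq> (\<Union>j\<in>J. W j)"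
    using compactE_image[OF \<open>compact K\<close>, of UNIV W] by metis
  let ?J = "{j\<in>J. V j \<noteq> {}}"
  define b where "b i = diameter (V i) + c i" for i
  have "K \<subseteq> (\<Union>j\<in>?J. W j)"
    using J(2) by (force simp: W_def)
  moreover have "0 < b j" for j
    using c(1)[of j] diameter_ge_0[OF bdd, of j] by (simp add: b_def)
  moreover have "dist x y \<le> b j" if xy: "x \<in> W j" "y \<in> W j" for x y j
  proof -
    obtain p q where "p \<in> V j" "x \<in> ball p (c j / 2)" "q \<in> V j" "y \<in> ball q (c j / 2)"
      using xy unfolding W_def by blast
    then have pq: "p \<in> V j" "dist p x < c j / 2" "q \<in> V j" "dist q y < c j / 2" by simp_all
    then have "dist p q \<le> diameter (V j)" by (intro diameter_bounded_bound bdd)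
    with pq show ?thesis
      unfolding b_def using dist_triangle[of x y p] dist_triangle[of p y q] by (simp add: dist_commute)
  qed
  moreover have "(\<Sum>j\<in>?J. b j powr s) < \<eta>"
  proof -
    have "ennreal (\<Sum>j\<in>?J. diameter (V j) powr s) = (\<Sum>j\<in>?J. diameter_power s (V j))"
      using \<open>s \<noteq> 0\<close> by (simp add: diameter_power_def flip: sum_ennreal)
    also have "\<dots> \<le> (\<Sum>i. diameter_power s (V i))"
      using J by (intro sum_le_suminf) auto
    also have "\<dots> < ennreal e" by (rule sumV)
    finally have 1: "(\<Sum>j\<in>?J. diameter (V j) powr s) \<le> e"
      by (simp add: ennreal_less_iff sum_nonneg)
    have "(\<Sum>j\<in>?J. (1/2::real) ^ Suc j) \<le> (\<Sum>j. (1/2) ^ Suc j)"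
      using J power_half_series by (intro sum_le_suminf) (auto simp: sums_iff)
    also have "\<dots> = 1" using power_half_series by (simp add: sums_iff)
    finally have 2: "e * (\<Sum>j\<in>?J. (1/2::real) ^ Suc j) \<le> e"
      using e by (simp add: mult_left_le)
    have "(\<Sum>j\<in>?J. b j powr s) \<le> (\<Sum>j\<in>?J. diameter (V j) powr s) + e * (\<Sum>j\<in>?J. (1/2) ^ Suc j)"
      unfolding sum_distrib_left b_def sum.distrib[symmetric] by (rule sum_mono) (rule c(2))
    also have "\<dots> \<le> e + e" using 1 2 by simp
    finally show ?thesis using e \<open>0 < \<eta>\<close> by simp
  qed
  ultimately show ?thesis using J(1)
    by (intro exI[of _ ?J] exI[of _ W] exI[of _ b]) auto
qed

text \<open>A mass distribution principle without a measure: covering sets smaller than the gap \<open>\<delta>\<close>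
  split into covers of the separate pieces, which are pulled back to smaller covers of \<open>K\<close>.\<close>

lemma separated_similarities_cover_ge:
  fixes f :: "'i \<Rightarrow> 'a::metric_space \<Rightarrow> 'a" and V :: "'j \<Rightarrow> 'a set"
  assumes I: "finite I" "2 \<le> card I" and c: "\<And>i. i \<in> I \<Longrightarrow> 0 < c i"
    and f: "\<And>i x y. i \<in> I \<Longrightarrow> dist (f i x) (f i y) = c i * dist x y"
    and fK: "\<And>i. i \<in> I \<Longrightarrow> f i ` K \<subseteq> K"
    and sep: "\<And>i j x y. i \<in> I \<Longrightarrow> j \<in> I \<Longrightarrow> i \<noteq> j \<Longrightarrow> x \<in> K \<Longrightarrow> y \<in> K \<Longrightarrow> \<delta> \<le> dist (f i x) (f j y)"
    and \<delta>: "0 < \<delta>" and s: "0 \<le> s" and ge1: "1 \<le> (\<Sum>i\<in>I. c i powr s)" and "K \<noteq> {}"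
    and "finite J" "K \<subseteq> (\<Union>j\<in>J. V j)" "\<And>j. j \<in> J \<Longrightarrow> 0 < b j"
    and "\<And>j x y. j \<in> J \<Longrightarrow> x \<in> V j \<Longrightarrow> y \<in> V j \<Longrightarrow> dist x y \<le> b j"
  shows "\<delta> powr s \<le> (\<Sum>j\<in>J. b j powr s)"
  using assms(11-14)
proof (induction "card J" arbitrary: J V b rule: less_induct)
  case less
  show ?case
  proof (cases "\<exists>j\<in>J. \<delta> \<le> b j")
    case True
    then obtain j where j: "j \<in> J" "\<delta> \<le> b j" by auto
    then have "\<delta> powr s \<le> b j powr s" using \<delta> s by (intro powr_mono2) auto
    also have "\<dots> \<le> (\<Sum>j\<in>J. b j powr s)"
      using j less.prems(1) by (intro member_le_sum) auto
    finally show ?thesis .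
  next
    case False
    \<comment> \<open>All bounds are now below the gap, so no covering set meets two pieces and the
      sets \<open>A i\<close> are disjoint. Since there are at least two pieces, each
      \<open>A i\<close> is a proper subset of J, and the induction on \<open>card J\<close> applies
      to its pullback under \<open>f i\<close>.\<close>
    define A where "A i = {j\<in>J. V j \<inter> f i ` K \<noteq> {}}" for i
    have disj: "A i \<inter> A k = {}" if "i \<in> I" "k \<in> I" "i \<noteq> k" for i k
    proof (rule ccontr)
      assume "A i \<inter> A k \<noteq> {}"
      then obtain j x y where "j \<in> J" "x \<in> K" "y \<in> K" "f i x \<in> V j" "f k y \<in> V j"
        by (auto simp: A_def)
      then have "\<delta> \<le> b j"
        using sep[OF that, of x y] less.prems(4)[of j "f i x" "f k y"] by simp
      with False \<open>j \<in> J\<close> show False by auto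
    qed
    have ne: "A i \<noteq> {}" if "i \<in> I" for i
    proof -
      obtain x where "x \<in> K" using \<open>K \<noteq> {}\<close> by auto
      then have "f i x \<in> (\<Union>j\<in>J. V j)" using fK[OF that] less.prems(2) by auto
      with \<open>x \<in> K\<close> show ?thesis by (auto simp: A_def)
    qed
    have piece: "c i powr s * \<delta> powr s \<le> (\<Sum>j\<in>A i. b j powr s)" if i: "i \<in> I" for i
    proof -
      obtain k where k: "k \<in> I" "k \<noteq> i"
        using I i by (metis card_2_iff' card_le_Suc0_iff_eq not_less_eq_eq numeral_2_eq_2)
      have "A k \<subseteq> J" "A i \<subseteq> J" by (auto simp: A_def)
      then have "A i \<subset> J" using ne[OF k(1)] disj[OF k(1) i k(2)] by auto
      then have "card (A i) < card J" using less.prems(1) by (simp add: psubset_card_mono)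
      then have "\<delta> powr s \<le> (\<Sum>j\<in>A i. (b j / c i) powr s)"
      proof (rule less.hyps[of "A i" "\<lambda>j. f i -` V j" "\<lambda>j. b j / c i"])
        show "finite (A i)" using less.prems(1) by (simp add: A_def)
        show "K \<subseteq> (\<Union>j\<in>A i. f i -` V j)"
        proof
          fix x assume x: "x \<in> K"
          then have "f i x \<in> (\<Union>j\<in>J. V j)" using fK[OF i] less.prems(2) by auto
          with x show "x \<in> (\<Union>j\<in>A i. f i -` V j)" by (auto simp: A_def)
        qed
        show "0 < b j / c i" if "j \<in> A i" for j
          using that c[OF i] less.prems(3) by (simp add: A_def)
        show "dist x y \<le> b j / c i" if "j \<in> A i" "x \<in> f i -` V j" "y \<in> f i -` V j" for j x y
          using that less.prems(4)[of j "f i x" "f i y"] f[OF i, of x y] c[OF i]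
          by (simp add: A_def field_simps)
      qed
      also have "\<dots> = (\<Sum>j\<in>A i. b j powr s) / c i powr s"
        using less.prems(3) c[OF i] unfolding sum_divide_distrib
        by (intro sum.cong) (auto simp: A_def powr_divide less_imp_le)
      finally show ?thesis using c[OF i] by (simp add: field_simps)
    qed
    have "\<delta> powr s \<le> (\<Sum>i\<in>I. c i powr s) * \<delta> powr s"
      using ge1 mult_right_mono[OF ge1, of "\<delta> powr s"] by simp
    also have "\<dots> \<le> (\<Sum>i\<in>I. \<Sum>j\<in>A i. b j powr s)"
      unfolding sum_distrib_right by (rule sum_mono) (rule piece)
    also have "\<dots> = (\<Sum>j\<in>(\<Union>i\<in>I. A i). b j powr s)"
      using I less.prems(1) disj by (intro sum.UNION_disjoint[symmetric]) (auto simp: A_def)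
    also have "\<dots> \<le> (\<Sum>j\<in>J. b j powr s)"
      using less.prems(1) by (intro sum_mono2) (auto simp: A_def)
    finally show ?thesis .
  qed
qed

section \<open>Cylinders of a self-similar set\<close>

lemma foldr_linear_part:
  assumes "\<forall>i\<in>set w. \<forall>x. S i x = r i *\<^sub>R T i x + v i"
    and "\<forall>i\<in>set w. orthogonal_transformation (T i)"
  shows "foldr S w x = prod_list (map r w) *\<^sub>R foldr T w x + foldr S w 0"
  using assms
proof (induction w)
  case (Cons i w)
  then have "linear (T i)" by (simp add: orthogonal_transformation_linear)
  with Cons.prems(1) show ?case
    by (subst foldr_Cons, subst foldr_Cons, subst o_apply, subst Cons.IH)
      (use Cons.prems in \<open>simp_all add: linear_add linear_cmul scaleR_add_right\<close>)
qed simp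

locale self_similar_set =
  fixes I :: "'i set" and S T :: "'i \<Rightarrow> 'a::euclidean_space \<Rightarrow> 'a"
    and r :: "'i \<Rightarrow> real" and v :: "'i \<Rightarrow> 'a" and K :: "'a set"
  assumes finite_I: "finite I"
    and r_pos: "i \<in> I \<Longrightarrow> 0 < r i" and r_lt_1: "i \<in> I \<Longrightarrow> r i < 1"
    and orthogonal_T: "i \<in> I \<Longrightarrow> orthogonal_transformation (T i)"
    and S_eq: "i \<in> I \<Longrightarrow> S i x = r i *\<^sub>R T i x + v i"
    and compact_K: "compact K" and K_eq: "K = (\<Union>i\<in>I. S i ` K)"
    and nontrivial: "\<exists>x\<in>K. \<exists>y\<in>K. x \<noteq> y"
begin

definition words :: "'i list set" where "words = lists I"

abbreviation "ratio w \<equiv> prod_list (map r w)"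
abbreviation "cyl w \<equiv> foldr S w ` K"
abbreviation "centre w \<equiv> foldr S w 0"

lemma Nil_in_words [simp]: "[] \<in> words"
  and Cons_in_words [simp]: "i # w \<in> words \<longleftrightarrow> i \<in> I \<and> w \<in> words"
  and append_in_words [simp]: "u @ w \<in> words \<longleftrightarrow> u \<in> words \<and> w \<in> words"
  by (auto simp: words_def)

lemma K_nonempty: "K \<noteq> {}" using nontrivial by auto

lemma orthogonal_word: "w \<in> words \<Longrightarrow> orthogonal_transformation (foldr T w)"
proof (induction w)
  case Nil
  then show ?case by (simp add: orthogonal_transformation_def linear_id)
next
  case (Cons i w)
  then show ?case
    using orthogonal_transformation_compose[OF orthogonal_T, of i "foldr T w"] by (simp add: comp_def)
qed

lemma linear_word: "w \<in> words \<Longrightarrow> linear (foldr T w)"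
  and norm_word [simp]: "w \<in> words \<Longrightarrow> norm (foldr T w x) = norm x"
  using orthogonal_word[of w] by (auto simp: orthogonal_transformation)

lemma ratio_pos: "w \<in> words \<Longrightarrow> 0 < ratio w"
  by (induction w) (auto intro!: mult_pos_pos r_pos)

lemma ratio_le_1: "w \<in> words \<Longrightarrow> ratio w \<le> 1"
  by (induction w) (auto intro!: mult_le_one less_imp_le[OF r_lt_1] less_imp_le[OF ratio_pos])

lemma word_eq: "w \<in> words \<Longrightarrow> foldr S w x = ratio w *\<^sub>R foldr T w x + centre w"
  by (rule foldr_linear_part[of w S r T v]) (auto simp: S_eq orthogonal_T words_def)

lemma word_diff:
  assumes "w \<in> words"
  shows "foldr S w x - foldr S w y = ratio w *\<^sub>R foldr T w (x - y)"
  using assms word_eq[of w x] word_eq[of w y]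
  by (simp add: linear_diff[OF linear_word] scaleR_diff_right)

lemma dist_word:
  assumes "w \<in> words"
  shows "dist (foldr S w x) (foldr S w y) = ratio w * dist x y"
  using assms ratio_pos[of w] by (simp add: dist_norm word_diff)

lemma inj_word: "w \<in> words \<Longrightarrow> inj (foldr S w)"
  using dist_word[of w] ratio_pos[of w] by (auto simp: inj_def) (metis dist_eq_0_iff mult_eq_0_iff less_irrefl)

lemma cyl_subset: "w \<in> words \<Longrightarrow> cyl w \<subseteq> K"
proof (induction w)
  case (Cons i w)
  then have "foldr S (i # w) ` K \<subseteq> S i ` K" "i \<in> I" by auto
  then show ?case using K_eq by blast
qed simp

lemma cyl_append: "cyl (u @ w) = foldr S u ` cyl w"
  by (simp add: image_comp comp_def)

lemma cyl_append_subset: "w \<in> words \<Longrightarrow> cyl (u @ w) \<subseteq> cyl u"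
  unfolding cyl_append using cyl_subset by blast

lemma cyl_nonempty: "cyl w \<noteq> {}" using K_nonempty by simp

lemma compact_cyl: "w \<in> words \<Longrightarrow> compact (cyl w)"
proof (rule compact_continuous_image[OF _ compact_K])
  assume w: "w \<in> words"
  show "continuous_on K (foldr S w)"
    unfolding continuous_on_iff
  proof (intro ballI allI impI)
    fix x and e :: real assume "0 < e"
    then show "\<exists>d>0. \<forall>x'\<in>K. dist x' x < d \<longrightarrow> dist (foldr S w x') (foldr S w x) < e"
      using dist_word[OF w] ratio_pos[OF w]
      by (intro exI[of _ "e / ratio w"]) (auto simp: field_simps)
  qed
qed

definition rmin :: real where "rmin = Min (r ` I)"

lemma I_nonempty: "I \<noteq> {}" using K_nonempty K_eq by auto

lemma rmin_pos: "0 < rmin" and rmin_le: "i \<in> I \<Longrightarrow> rmin \<le> r i"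
  using I_nonempty finite_I r_pos by (auto simp: rmin_def)

lemma rmin_lt_1: "rmin < 1"
  using I_nonempty rmin_le r_lt_1 by (metis all_not_in_conv le_less_trans)

definition rmax :: real where "rmax = Max (r ` I)"

lemma rmax_lt_1: "rmax < 1" and rmax_ge: "i \<in> I \<Longrightarrow> r i \<le> rmax" and rmax_pos: "0 < rmax"
proof -
  show "rmax < 1" using I_nonempty finite_I r_lt_1 by (auto simp: rmax_def)
  show ge: "r i \<le> rmax" if "i \<in> I" for i using that finite_I by (auto simp: rmax_def)
  show "0 < rmax" using I_nonempty ge r_pos by (metis all_not_in_conv less_le_trans)
qed

lemma ratio_le_rmax_power: "w \<in> words \<Longrightarrow> ratio w \<le> rmax ^ length w"
proof (induction w)
  case (Cons i w)
  then show ?case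
    using rmax_pos ratio_pos[of w] by (auto intro!: mult_mono rmax_ge simp: less_imp_le)
qed simp

lemma finite_words_ratio_gt:
  assumes "0 < s" shows "finite {w\<in>words. s < ratio w}"
proof -
  obtain n where n: "rmax ^ n < s"
    using real_arch_pow_inv[OF assms rmax_lt_1] by auto
  have "length w \<le> n" if "w \<in> words" "s < ratio w" for w
  proof (rule ccontr)
    assume "\<not> length w \<le> n"
    then have "rmax ^ length w \<le> rmax ^ n"
      using rmax_pos rmax_lt_1 by (intro power_decreasing) auto
    with that n ratio_le_rmax_power[of w] show False by simp
  qed
  then have "{w\<in>words. s < ratio w} \<subseteq> {w. set w \<subseteq> I \<and> length w \<le> n}" by (auto simp: words_def)
  then show ?thesis by (rule finite_subset) (simp add: finite_lists_length_le finite_I)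
qed

text \<open>Follow an address of x letter by letter and stop as soon as the ratio is at most s. One
  letter shrinks the ratio by no more than the factor \<open>rmin\<close>, and
  \<open>rmax < 1\<close> forces the stop.\<close>

lemma exists_word_of_ratio:
  assumes "x \<in> K" "0 < s" "s < 1"
  shows "\<exists>w\<in>words. x \<in> cyl w \<and> rmin * s < ratio w \<and> ratio w \<le> s"
proof -
  have ex: "\<exists>w\<in>words. length w = n \<and> x \<in> cyl w \<and> (s < ratio w \<or> rmin * s < ratio w \<and> ratio w \<le> s) \<or>
        (\<exists>w\<in>words. x \<in> cyl w \<and> rmin * s < ratio w \<and> ratio w \<le> s)" for n
  proof (induction n)
    case 0
    then show ?case using assms by (intro bexI[of _ "[]"]) auto
  next
    case (Suc n)
    show ?case
    proof (cases "\<exists>w\<in>words. x \<in> cyl w \<and> rmin * s < ratio w \<and> ratio w \<le> s")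
      case False
      with Suc obtain w where w: "w \<in> words" "length w = n" "x \<in> cyl w" "s < ratio w" by blast
      then obtain y where y: "y \<in> K" "x = foldr S w y" by auto
      then obtain i z where i: "i \<in> I" "z \<in> K" "y = S i z" using K_eq by blast
      then have "w @ [i] \<in> words" "length (w @ [i]) = Suc n" "x \<in> cyl (w @ [i])" using w y by auto
      moreover have "rmin * s < ratio (w @ [i])"
        using mult_le_less_imp_less[of rmin "r i" s "ratio w"] rmin_le[OF i(1)] rmin_pos w(4) assms
        by (simp add: mult.commute)
      ultimately show ?thesis by (metis linorder_not_less)
    qed (use Suc in auto)
  qed
  obtain n where n: "rmax ^ n < s"
    using real_arch_pow_inv[OF assms(2) rmax_lt_1] by auto
  have "\<not> s < ratio w" if "w \<in> words" "length w = n" for w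
    using ratio_le_rmax_power[of w] that n by simp
  then show ?thesis using ex[of n] by blast
qed

section \<open>Content of disjoint families of cylinders\<close>

definition disj :: "'i list set \<Rightarrow> bool" where
  "disj F \<longleftrightarrow> finite F \<and> F \<subseteq> words \<and> disjoint_family_on (\<lambda>w. cyl w) F"

abbreviation content :: "'i list set \<Rightarrow> real" where
  "content F \<equiv> (\<Sum>w\<in>F. ratio w powr hausdorff_dim K)"

text \<open>\<open>hausdorff_dim\<close> is an infimum of reals, so lower-bound arguments with it
  require a nonempty set of null exponents. The exponent is an integer so large that the powers of
  the ratios sum to at most 1/2; then the cylinders of level k cost at most D^s / 2^k.\<close>

lemma exists_null_exponent: "\<exists>s\<ge>0. hausdorff_measure s K = 0"
proof -
  have card_pos: "0 < card I" using finite_I I_nonempty by (simp add: card_gt_0_iff)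
  obtain n where n: "rmax ^ n < 1 / (2 * real (card I))"
    using real_arch_pow_inv[OF _ rmax_lt_1, of "1 / (2 * real (card I))"] card_pos by auto
  define s where "s = real (Suc n)"
  obtain D where D: "\<And>x y. x \<in> K \<Longrightarrow> y \<in> K \<Longrightarrow> dist x y \<le> D" "0 < D"
  proof -
    have "dist x y \<le> diameter K + 1" if "x \<in> K" "y \<in> K" for x y
      using diameter_bounded_bound[OF compact_imp_bounded[OF compact_K] that] by simp
    moreover have "0 < diameter K + 1" using diameter_ge_0[OF compact_imp_bounded[OF compact_K]] by simp
    ultimately show ?thesis using that by blast
  qed
  define L where "L k = {w. set w \<subseteq> I \<and> length w = k}" for k
  have finL: "finite (L k)" for k unfolding L_def by (rule finite_lists_length_eq) (rule finite_I)
  have LS: "L (Suc k) = (\<lambda>(i, w). i # w) ` (I \<times> L k)" for k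
    by (auto simp: L_def length_Suc_conv image_iff)
  have cover: "K \<subseteq> (\<Union>w\<in>L k. cyl w)" for k
  proof (induction k)
    case (Suc k)
    show ?case
    proof
      fix x assume "x \<in> K"
      then obtain i y where "i \<in> I" "y \<in> K" "x = S i y" using K_eq by blast
      moreover from this obtain w where "w \<in> L k" "y \<in> cyl w" using Suc by auto
      ultimately show "x \<in> (\<Union>w\<in>L (Suc k). cyl w)" unfolding LS by force
    qed
  qed (simp add: L_def)
  have "(\<Sum>i\<in>I. r i powr s) \<le> (\<Sum>i\<in>I. 1 / (2 * real (card I)))"
  proof (rule sum_mono)
    fix i assume i: "i \<in> I"
    have "r i powr s = r i ^ Suc n" unfolding s_def using r_pos[OF i] by (simp add: powr_realpow flip: of_nat_Suc)
    also have "\<dots> \<le> rmax ^ Suc n" using rmax_ge[OF i] r_pos[OF i] by (intro power_mono) auto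
    also have "\<dots> \<le> rmax ^ n" using rmax_pos rmax_lt_1 by (intro power_decreasing) auto
    finally show "r i powr s \<le> 1 / (2 * real (card I))" using n by simp
  qed
  also have "\<dots> = 1 / 2" using card_pos by simp
  finally have half: "(\<Sum>i\<in>I. r i powr s) \<le> 1 / 2" .
  have sumL: "(\<Sum>w\<in>L k. ratio w powr s) \<le> (1 / 2) ^ k" for k
  proof (induction k)
    case (Suc k)
    have "(\<Sum>w\<in>L (Suc k). ratio w powr s) = (\<Sum>(i, w)\<in>I \<times> L k. r i powr s * ratio w powr s)"
      unfolding LS by (subst sum.reindex) (auto intro!: inj_onI sum.cong powr_mult
          simp: r_pos less_imp_le L_def subset_iff ratio_pos words_def)
    also have "\<dots> = (\<Sum>i\<in>I. r i powr s) * (\<Sum>w\<in>L k. ratio w powr s)"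
      by (simp add: sum_product sum.cartesian_product)
    also have "\<dots> \<le> (1 / 2) * (1 / 2) ^ k"
      using half Suc by (intro mult_mono) (auto intro!: sum_nonneg)
    finally show ?case by simp
  next
    case 0
    have "L 0 = {[]}" by (auto simp: L_def)
    then show ?case by simp
  qed
  have "hausdorff_measure s K = 0"
  proof (rule hausdorff_measure_eq_0I[where 'i = "'i list"])
    show "0 < s" by (simp add: s_def)
    fix \<delta> \<epsilon> :: real assume pos: "0 < \<delta>" "0 < \<epsilon>"
    have "(\<lambda>k. rmax ^ k * D) \<longlonglongrightarrow> 0 * D" "(\<lambda>k. (1 / 2) ^ k * D powr s) \<longlonglongrightarrow> 0 * D powr s"
      using rmax_pos rmax_lt_1 by (intro tendsto_intros LIMSEQ_realpow_zero; simp)+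
    then have "\<forall>\<^sub>F k in sequentially. rmax ^ k * D < \<delta> \<and> (1 / 2) ^ k * D powr s < \<epsilon>"
      using pos by (intro eventually_conj order_tendstoD(2)[where a = \<delta>] order_tendstoD(2)[where a = \<epsilon>]) auto
    then obtain k where k: "rmax ^ k * D < \<delta>" "(1 / 2) ^ k * D powr s < \<epsilon>"
      by (auto dest: eventually_happens)
    have dist: "dist x y \<le> ratio w * D" if w: "w \<in> L k" and "x \<in> cyl w" "y \<in> cyl w" for w x y
    proof -
      have "w \<in> words" using w by (auto simp: L_def words_def)
      with that(2,3) show ?thesis using ratio_pos[of w] D(1) by (auto simp: dist_word)
    qed
    have le: "0 \<le> ratio w * D \<and> ratio w * D \<le> \<delta>" if "w \<in> L k" for w
    proof -
      have "w \<in> words" "length w = k" using that by (auto simp: L_def words_def)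
      then have "0 < ratio w" "ratio w * D \<le> rmax ^ k * D"
        using ratio_pos ratio_le_rmax_power[of w] D(2) by auto
      then show ?thesis using k(1) D(2) by (intro conjI mult_nonneg_nonneg) linarith+
    qed
    have "(\<Sum>w\<in>L k. (ratio w * D) powr s) = (\<Sum>w\<in>L k. ratio w powr s) * D powr s"
      unfolding sum_distrib_right
      by (intro sum.cong powr_mult) (auto simp: L_def subset_iff D less_imp_le words_def intro!: less_imp_le[OF ratio_pos])
    also have "\<dots> \<le> (1 / 2) ^ k * D powr s" by (intro mult_right_mono sumL) simp
    finally have "(\<Sum>w\<in>L k. (ratio w * D) powr s) \<le> \<epsilon>" using k by simp
    with finL cover dist le show "\<exists>(I::'i list set) V b. finite I \<and> K \<subseteq> (\<Union>i\<in>I. V i) \<and>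
      (\<forall>i\<in>I. 0 \<le> b i \<and> b i \<le> \<delta> \<and> (\<forall>x\<in>V i. \<forall>y\<in>V i. dist x y \<le> b i)) \<and> (\<Sum>i\<in>I. b i powr s) \<le> \<epsilon>"
      by (intro exI[of _ "L k"] exI[of _ "\<lambda>w. cyl w"] exI[of _ "\<lambda>w. ratio w * D"]) blast
  qed
  then show ?thesis by (intro exI[of _ s]) (simp add: s_def)
qed

lemma hausdorff_dim_nonneg: "0 \<le> hausdorff_dim K"
  unfolding hausdorff_dim_def using exists_null_exponent by (intro cInf_greatest) auto

text \<open>A content above 1 stays above 1 for exponents slightly larger than the dimension, among
  which there is a null exponent s if the dimension itself is not null. The maps of F send K into K
  with a positive gap between the images, so \<open>separated_similarities_cover_ge\<close> bounds
  the s-cost of every finite cover of K from below, against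
  \<open>hausdorff_null_finite_cover\<close>.\<close>

lemma disjoint_cyl_content_le_1:
  assumes "disj F" shows "content F \<le> 1"
proof (rule ccontr)
  let ?t = "hausdorff_dim K"
  assume "\<not> content F \<le> 1"
  then have gt: "1 < content F" by simp
  have fin: "finite F" and words: "F \<subseteq> words" and dis: "disjoint_family_on (\<lambda>w. cyl w) F"
    using assms by (auto simp: disj_def)
  define X where "X = {s. 0 \<le> s \<and> hausdorff_measure s K = 0}"
  have X: "X \<noteq> {}" "bdd_below X" using exists_null_exponent by (auto simp: X_def intro!: bdd_belowI[of _ 0])
  have t: "?t = Inf X" by (simp add: hausdorff_dim_def X_def)
  have pos: "0 < ratio w" if "w \<in> F" for w using that words by (intro ratio_pos) auto
  have "((\<lambda>s. \<Sum>w\<in>F. ratio w powr s) \<longlongrightarrow> content F) (at_right ?t)"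
    by (intro tendsto_intros) (use pos in force)
  then have "\<forall>\<^sub>F s in at_right ?t. 1 < (\<Sum>w\<in>F. ratio w powr s)"
    using gt by (rule order_tendstoD)
  then obtain b where b: "?t < b" "\<And>s. ?t < s \<Longrightarrow> s < b \<Longrightarrow> 1 < (\<Sum>w\<in>F. ratio w powr s)"
    unfolding eventually_at_right_field by auto
  \<comment> \<open>The infimum may be attained, so s may equal the dimension; then the strict
    inequality comes from the assumption on the content instead of the choice of b.\<close>
  obtain s where s: "s \<in> X" "s < b" using cInf_lessD[OF X(1)] b(1) t by auto
  have ts: "?t \<le> s" unfolding t using X s by (intro cInf_lower)
  then have gt1: "1 < (\<Sum>w\<in>F. ratio w powr s)" using b s gt by (cases "?t = s") auto
  \<comment> \<open>Ratios are at most 1, so a single cylinder cannot push the sum above 1.\<close>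
  have "2 \<le> card F"
  proof (rule ccontr)
    assume "\<not> 2 \<le> card F"
    then have "card F \<le> 1" by simp
    have "(\<Sum>w\<in>F. ratio w powr s) \<le> (\<Sum>w\<in>F. 1)"
      using pos words ratio_le_1 ts hausdorff_dim_nonneg by (intro sum_mono powr_le1) (auto simp: subset_iff less_imp_le abs_of_pos)
    with gt1 \<open>card F \<le> 1\<close> show False by simp
  qed
  have "\<exists>d>0. \<forall>x\<in>cyl u. \<forall>y\<in>cyl w. d \<le> dist x y" if "u \<in> F" "w \<in> F" "u \<noteq> w" for u w
    using that words dis by (intro separate_compact_closed compact_imp_closed compact_cyl)
      (auto simp: disjoint_family_on_def)
  then obtain d where d: "\<And>u w. u \<in> F \<Longrightarrow> w \<in> F \<Longrightarrow> u \<noteq> w \<Longrightarrow> 0 < d u w \<and> (\<forall>x\<in>cyl u. \<forall>y\<in>cyl w. d u w \<le> dist x y)"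
    by metis
  define \<delta> where "\<delta> = Min (insert 1 ((\<lambda>(u, w). d u w) ` {(u, w) \<in> F \<times> F. u \<noteq> w}))"
  have finp: "finite {(u, w) \<in> F \<times> F. u \<noteq> w}" using fin by (rule_tac finite_subset[of _ "F \<times> F"]) auto
  have \<delta>: "0 < \<delta>" unfolding \<delta>_def using finp d by (subst Min_gr_iff) auto
  have \<delta>_le: "\<delta> \<le> d u w" if "u \<in> F" "w \<in> F" "u \<noteq> w" for u w
    unfolding \<delta>_def using finp that by (intro Min_le) auto
  have sX: "0 \<le> s" "hausdorff_measure s K = 0" and "0 < \<delta> powr s" using s(1) \<delta> by (auto simp: X_def)
  from hausdorff_null_finite_cover[OF compact_K K_nonempty this]
  obtain J :: "nat set" and W b where J: "finite J" "K \<subseteq> (\<Union>j\<in>J. W j)" "(\<Sum>j\<in>J. b j powr s) < \<delta> powr s"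
    and Wb: "\<And>j. j \<in> J \<Longrightarrow> 0 < b j" "\<And>j x y. j \<in> J \<Longrightarrow> x \<in> W j \<Longrightarrow> y \<in> W j \<Longrightarrow> dist x y \<le> b j"
    by blast
  have "\<delta> powr s \<le> (\<Sum>j\<in>J. b j powr s)"
  proof (rule separated_similarities_cover_ge[OF fin \<open>2 \<le> card F\<close>, where f = "foldr S" and c = "\<lambda>w. ratio w"])
    show "dist (foldr S w x) (foldr S w y) = ratio w * dist x y" if "w \<in> F" for w x y
      using that words by (auto simp: dist_word)
    show "cyl w \<subseteq> K" if "w \<in> F" for w using that words by (intro cyl_subset) auto
    show "\<delta> \<le> dist (foldr S u x) (foldr S w y)" if "u \<in> F" "w \<in> F" "u \<noteq> w" "x \<in> K" "y \<in> K" for u w x y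
      using \<delta>_le[OF that(1-3)] d[OF that(1-3)] that(4,5) by (meson imageI order_trans)
  qed (use pos \<delta> s gt1 J Wb K_nonempty in \<open>auto simp: X_def\<close>)
  with J(3) show False by simp
qed

end

section \<open>Rotating planes by words\<close>

lemma norm_orthogonal_projection_le:
  fixes N :: "'a::euclidean_space set"
  assumes "subspace N" shows "norm (orthogonal_projection N x) \<le> norm x"
proof -
  let ?p = "orthogonal_projection N x"
  have "orthogonal (x - ?p) ?p"
    using orthogonal_projection[OF assms] by auto
  then have "(norm x)\<^sup>2 = (norm (x - ?p))\<^sup>2 + (norm ?p)\<^sup>2"
    using norm_add_Pythagorean[of "x - ?p" ?p] by simp
  then show ?thesis by (metis le_add_same_cancel2 norm_ge_zero power2_le_imp_le zero_le_power2)
qed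

lemma linear_orthogonal_projection:
  "subspace N \<Longrightarrow> linear (orthogonal_projection (N :: 'a::euclidean_space set))"
  by (simp add: bounded_linear.linear bounded_linear_orthogonal_projection)

lemma orthogonal_projection_image:
  fixes N :: "'a::euclidean_space set"
  assumes "orthogonal_transformation f" "subspace N"
  shows "orthogonal_projection (f ` N) (f x) = f (orthogonal_projection N x)"
proof (rule orthogonal_projection_eqI)
  have lin: "linear f" using assms(1) by (rule orthogonal_transformation_linear)
  show "subspace (f ` N)" by (rule linear_subspace_image[OF lin assms(2)])
  show "f (orthogonal_projection N x) \<in> f ` N"
    using orthogonal_projection(1)[OF assms(2)] by auto
  show "orthogonal (f x - f (orthogonal_projection N x)) z" if "z \<in> f ` N" for z
    using that orthogonal_projection(2)[OF assms(2)] assms(1)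
    by (auto simp: orthogonal_def orthogonal_transformation_def simp flip: linear_diff[OF lin])
qed

lemma grassmannian_image:
  fixes N :: "'a::euclidean_space set"
  assumes "orthogonal_transformation f" "N \<in> grassmannian l"
  shows "f ` N \<in> grassmannian l"
proof -
  have lin: "linear f" using assms(1) by (rule orthogonal_transformation_linear)
  have "dim (f ` N) = dim N"
    by (rule dim_image_eq[OF lin]) (rule inj_on_subset[OF orthogonal_transformation_inj[OF assms(1)]], simp)
  then show ?thesis
    using assms(2) linear_subspace_image[OF lin] by (auto simp: grassmannian_def)
qed

lemma norm_orthogonal_projection_diff_le:
  fixes M N :: "'a::euclidean_space set"
  assumes "subspace M" "subspace N"
  shows "norm (orthogonal_projection M x - orthogonal_projection N x) \<le> grassmann_dist M N * norm x"
  using norm_blinfun[of "Blinfun (orthogonal_projection M) - Blinfun (orthogonal_projection N)" x]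
  by (simp add: grassmann_dist_def blinfun.diff_left bounded_linear_Blinfun_apply
      bounded_linear_orthogonal_projection assms)

lemma norm_orthogonal_projection_le_dist:
  fixes M N :: "'a::euclidean_space set"
  assumes "subspace M" "subspace N" "grassmann_dist M N \<le> \<epsilon>"
  shows "norm (orthogonal_projection M x) \<le> norm (orthogonal_projection N x) + \<epsilon> * norm x"
proof -
  have "norm (orthogonal_projection M x - orthogonal_projection N x) \<le> \<epsilon> * norm x"
    using norm_orthogonal_projection_diff_le[OF assms(1,2), of x] mult_right_mono[OF assms(3) norm_ge_zero[of x]]
    by linarith
  then show ?thesis
    using norm_triangle_sub[of "orthogonal_projection M x" "orthogonal_projection N x"] by linarith
qed

text \<open>Projections have norm at most 1 in a finite-dimensional space of operators, so their
  closure is compact. Covering it by balls centred at projections keeps the net inside the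
  Grassmannian.\<close>

lemma grassmannian_totally_bounded:
  assumes "0 < \<delta>"
  shows "\<exists>F. finite F \<and> F \<subseteq> (grassmannian l :: 'a::euclidean_space set set) \<and>
    (\<forall>N\<in>grassmannian l. \<exists>N'\<in>F. grassmann_dist N N' < \<delta>)"
proof -
  let ?p = "\<lambda>N :: 'a set. Blinfun (orthogonal_projection N)"
  have "norm (?p N) \<le> 1" if "N \<in> grassmannian l" for N
    using that norm_orthogonal_projection_le[of N]
    by (intro norm_blinfun_bound)
      (auto simp: bounded_linear_Blinfun_apply bounded_linear_orthogonal_projection grassmannian_def)
  then have "bounded (?p ` grassmannian l)" unfolding bounded_iff by auto
  then have cpt: "compact (closure (?p ` grassmannian l))" by (simp add: compact_closure)
  have cov: "closure (?p ` grassmannian l) \<subseteq> (\<Union>x\<in>?p ` grassmannian l. ball x \<delta>)"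
  proof
    fix y assume "y \<in> closure (?p ` grassmannian l)"
    then obtain x where "x \<in> ?p ` grassmannian l" "dist x y < \<delta>"
      using assms unfolding closure_approachable by blast
    then show "y \<in> (\<Union>x\<in>?p ` grassmannian l. ball x \<delta>)" by (intro UN_I[of x]) simp_all
  qed
  obtain D where D: "D \<subseteq> ?p ` grassmannian l" "finite D"
      "closure (?p ` grassmannian l) \<subseteq> (\<Union>x\<in>D. ball x \<delta>)"
    by (rule compactE_image[OF cpt open_ball cov])
  obtain F where F: "F \<subseteq> grassmannian l" "finite F" "D = ?p ` F"
    using finite_subset_image[OF D(2,1)] by (elim exE conjE) blast
  have "\<exists>N'\<in>F. grassmann_dist N N' < \<delta>" if "N \<in> grassmannian l" for N
  proof -
    have "?p N \<in> closure (?p ` grassmannian l)" by (intro subsetD[OF closure_subset] imageI that)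
    then have "?p N \<in> (\<Union>x\<in>D. ball x \<delta>)" using D(3) by (rule rev_subsetD)
    then show ?thesis unfolding F(3) by (auto simp: grassmann_dist_def dist_norm norm_minus_commute)
  qed
  with F show ?thesis by blast
qed

text \<open>The orthogonal complement of b has dimension at least d - 1, which is at least l, so it
  contains an l-plane.\<close>

lemma exists_grassmannian_projecting_to_0:
  fixes b :: "'a::euclidean_space"
  assumes "l < DIM('a)"
  shows "\<exists>N\<in>grassmannian l. orthogonal_projection N b = 0"
proof -
  have "l \<le> dim {x. b \<bullet> x = 0}"
  proof (cases "b = 0")
    case True
    then show ?thesis using assms by simp
  next
    case False
    then show ?thesis using assms by (simp add: dim_hyperplane)
  qed
  then obtain N where N: "subspace N" "N \<subseteq> span {x. b \<bullet> x = 0}" "dim N = l"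
    by (rule choose_subspace_of_subspace)
  have "N \<subseteq> {x. b \<bullet> x = 0}"
    using N(2) span_minimal[OF order_refl subspace_hyperplane[of b]] by (rule order_trans)
  then have "orthogonal_projection N b = 0"
    using N by (intro orthogonal_projection_eqI) (auto simp: subspace_0 orthogonal_def subset_iff)
  with N show ?thesis by (auto simp: grassmannian_def)
qed

text \<open>The powers of f form a bounded sequence of operators in finite dimension, so two of them
  are close; cancelling the smaller power, an isometry, leaves a power close to the
  identity.\<close>

lemma orthogonal_transformation_recurrent:
  fixes f :: "'a::euclidean_space \<Rightarrow> 'a"
  assumes f: "orthogonal_transformation f" and "0 < \<epsilon>"
  shows "\<exists>k>0. \<forall>x. norm ((f ^^ k) x - x) \<le> \<epsilon> * norm x"
proof -
  have orth: "orthogonal_transformation (f ^^ k)" for k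
  proof (induction k)
    case (Suc k)
    then show ?case using orthogonal_transformation_compose[OF f] by (simp add: comp_def)
  qed (simp add: orthogonal_transformation_def linear_id)
  have lin: "bounded_linear (f ^^ k)" and nrm: "norm ((f ^^ k) x) = norm x" for k x
    using orth[of k] by (auto simp: orthogonal_transformation linear_conv_bounded_linear)
  define F where "F k = Blinfun (f ^^ k)" for k
  have F: "blinfun_apply (F k) = f ^^ k" for k
    by (simp add: F_def bounded_linear_Blinfun_apply lin)
  have "norm (F k) \<le> 1" for k
    by (rule norm_blinfun_bound) (auto simp: F nrm)
  then have "bounded (range F)" unfolding bounded_iff by auto
  then obtain L s where s: "strict_mono s" "(F \<circ> s) \<longlonglongrightarrow> L"
    using bounded_imp_convergent_subsequence by blast
  then have "Cauchy (F \<circ> s)" by (intro LIMSEQ_imp_Cauchy)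
  then obtain n where "norm ((F \<circ> s) n - (F \<circ> s) (Suc n)) < \<epsilon>"
    using CauchyD[OF _ \<open>0 < \<epsilon>\<close>] by (meson le_SucI order_refl)
  then have n: "norm (F (s (Suc n)) - F (s n)) \<le> \<epsilon>" by (simp add: norm_minus_commute)
  define k where "k = s (Suc n) - s n"
  have lt: "s n < s (Suc n)" using s(1) by (simp add: strict_mono_Suc_iff)
  have "norm ((f ^^ k) x - x) \<le> \<epsilon> * norm x" for x
  proof -
    have ex: "(f ^^ s n) ((f ^^ k) x) = (f ^^ s (Suc n)) x"
      using lt by (simp add: k_def flip: funpow_add comp_apply[of "f ^^ s n"])
    have "norm ((f ^^ k) x - x) = norm ((f ^^ s n) ((f ^^ k) x - x))" by (simp add: nrm)
    also have "\<dots> = norm (blinfun_apply (F (s (Suc n)) - F (s n)) x)"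
      using bounded_linear.linear[OF lin[of "s n"]] by (simp add: linear_diff ex F blinfun.diff_left)
    also have "\<dots> \<le> norm (F (s (Suc n)) - F (s n)) * norm x" by (rule norm_blinfun)
    also have "\<dots> \<le> \<epsilon> * norm x" using n by (intro mult_right_mono) auto
    finally show ?thesis .
  qed
  with lt show ?thesis by (intro exI[of _ k]) (simp add: k_def)
qed

section \<open>Approximating the transformation group by words\<close>

lemma foldr_concat_replicate: "foldr f (concat (replicate k w)) = foldr f w ^^ k"
  by (induction k) (auto simp: fun_eq_iff)

lemma Bij_UNIV_iff [simp]: "f \<in> Bij UNIV \<longleftrightarrow> bij f"
  by (auto simp: Bij_def bij_def)

lemma mult_BijGroup_UNIV: "bij f \<Longrightarrow> bij h \<Longrightarrow> f \<otimes>\<^bsub>BijGroup UNIV\<^esub> h = f \<circ> h"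
  by (simp add: BijGroup_def compose_def fun_eq_iff)

lemma inv_BijGroup_UNIV: "bij f \<Longrightarrow> inv\<^bsub>BijGroup UNIV\<^esub> f = inv_into UNIV f"
  by (simp add: inv_BijGroup fun_eq_iff)

locale dense_self_similar_set = self_similar_set I S T r v K
  for I :: "'i set" and S T :: "'i \<Rightarrow> 'a::euclidean_space \<Rightarrow> 'a"
    and r :: "'i \<Rightarrow> real" and v :: "'i \<Rightarrow> 'a" and K :: "'a set" +
  fixes l :: nat and M :: "'a set"
  assumes l_less: "l < DIM('a)" and M: "M \<in> grassmannian l"
    and dense: "grassmann_topology l closure_of {f ` M | f. f \<in> generate (BijGroup UNIV) (T ` I)} = grassmannian l"
begin

text \<open>Induction over the generated group. Products are handled by concatenation, where the
  errors add because the maps are isometries; this is why orthogonality is carried along. Inverses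
  of generators are handled by recurrence.\<close>

lemma generate_approx_word:
  assumes "f \<in> generate (BijGroup UNIV) (T ` I)"
  shows "orthogonal_transformation f \<and> (\<forall>\<epsilon>>0. \<exists>w\<in>words. \<forall>x. norm (f x - foldr T w x) \<le> \<epsilon> * norm x)"
  using assms
proof (induction rule: generate.induct)
  case one
  have "\<one>\<^bsub>BijGroup UNIV\<^esub> = (\<lambda>x :: 'a. x)" by (simp add: BijGroup_def fun_eq_iff)
  then show ?case by (auto simp: orthogonal_transformation_def linear_id intro!: bexI[of _ "[]"])
next
  case (incl h)
  then obtain i where "i \<in> I" "h = T i" by auto
  then show ?case by (auto simp: orthogonal_T intro!: bexI[of _ "[i]"])
next
  case (inv h)
  then obtain i where i: "i \<in> I" "h = T i" by auto
  then have orth: "orthogonal_transformation h" by (simp add: orthogonal_T)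
  then have bij: "bij h" by (rule orthogonal_transformation_bij)
  then have inv: "inv\<^bsub>BijGroup UNIV\<^esub> h = inv_into UNIV h" by (rule inv_BijGroup_UNIV)
  have "\<exists>w\<in>words. \<forall>x. norm (inv_into UNIV h x - foldr T w x) \<le> \<epsilon> * norm x" if \<epsilon>: "0 < \<epsilon>" for \<epsilon>
  proof -
    obtain k where k: "0 < k" "\<And>x. norm ((h ^^ k) x - x) \<le> \<epsilon> * norm x"
      using orthogonal_transformation_recurrent[OF orth \<epsilon>] by blast
    \<comment> \<open>Since \<open>h ^^ k\<close> is close to the identity,
      \<open>h ^^ (k - 1)\<close> is close to the inverse of h.\<close>
    define w where "w = concat (replicate (k - 1) [i])"
    have "w \<in> words" using i by (auto simp: w_def words_def)
    moreover have Tw: "foldr T w = h ^^ (k - 1)" unfolding w_def foldr_concat_replicate using i by simp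
    moreover have "norm (inv_into UNIV h x - foldr T w x) \<le> \<epsilon> * norm x" for x
    proof -
      have "h (foldr T w x) = (h ^^ k) x"
        unfolding Tw using k(1) by (metis Suc_pred' comp_apply funpow.simps(2) One_nat_def)
      moreover have "h (inv_into UNIV h x) = x" using bij by (simp add: bij_is_surj surj_f_inv_f)
      moreover have "norm (inv_into UNIV h x - foldr T w x) = norm (h (inv_into UNIV h x - foldr T w x))"
        using orth by (simp add: orthogonal_transformation)
      ultimately have "norm (inv_into UNIV h x - foldr T w x) = norm (x - (h ^^ k) x)"
        using linear_diff[OF orthogonal_transformation_linear[OF orth]] by simp
      with k(2)[of x] show ?thesis by (simp add: norm_minus_commute)
    qed
    ultimately show ?thesis by blast
  qed
  then show ?case unfolding inv using orthogonal_transformation_inv[OF orth] by blast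
next
  case (eng f h)
  have orth: "orthogonal_transformation f" "orthogonal_transformation h" using eng by auto
  have mult: "f \<otimes>\<^bsub>BijGroup UNIV\<^esub> h = f \<circ> h"
    by (intro mult_BijGroup_UNIV orthogonal_transformation_bij orth)
  have "\<exists>w\<in>words. \<forall>x. norm ((f \<circ> h) x - foldr T w x) \<le> \<epsilon> * norm x" if "0 < \<epsilon>" for \<epsilon>
  proof -
    have "0 < \<epsilon> / 2" using that by simp
    then obtain u w where u: "u \<in> words" "\<And>x. norm (f x - foldr T u x) \<le> \<epsilon> / 2 * norm x"
      and w: "w \<in> words" "\<And>x. norm (h x - foldr T w x) \<le> \<epsilon> / 2 * norm x"
      using eng.IH by metis
    have "norm (f (h x) - foldr T u (foldr T w x)) \<le> \<epsilon> * norm x" for x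
    proof -
      have "norm (f (h x) - f (foldr T w x)) = norm (h x - foldr T w x)"
        using orth(1) by (simp add: orthogonal_transformation linear_diff[symmetric])
      then show ?thesis
        using norm_triangle_ineq[of "f (h x) - f (foldr T w x)" "f (foldr T w x) - foldr T u (foldr T w x)"]
          u(2)[of "foldr T w x"] w(2)[of x] w(1) by simp
    qed
    then show ?thesis using u w by (intro bexI[of _ "u @ w"]) auto
  qed
  then show ?case unfolding mult using orthogonal_transformation_compose[OF orth] by blast
qed

lemma grassmannian_subspace: "N \<in> grassmannian l \<Longrightarrow> subspace N"
  by (simp add: grassmannian_def)

lemma orbit_approx:
  assumes N: "N \<in> grassmannian l" and "0 < \<epsilon>"
  shows "\<exists>f\<in>generate (BijGroup UNIV) (T ` I). grassmann_dist N (f ` M) < \<epsilon>"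
proof -
  interpret Metric_space "grassmannian l :: 'a set set" grassmann_dist
    by (rule Metric_space_grassmannian)
  have "N \<in> mtopology closure_of {f ` M | f. f \<in> generate (BijGroup UNIV) (T ` I)}"
    using N dense by (simp add: grassmann_topology_def)
  then obtain L where "L \<in> {f ` M | f. f \<in> generate (BijGroup UNIV) (T ` I)}" "L \<in> mball N \<epsilon>"
    unfolding metric_closure_of using \<open>0 < \<epsilon>\<close> by blast
  then show ?thesis by auto
qed

text \<open>The inequality is the usable form of "\<open>foldr T w\<close> carries N nearly onto
  N'". With N close to f(M) and N' close to f'(M), the word approximates f' composed with the
  inverse of f, which carries f(M) exactly onto f'(M). The three errors come from the word, from N'
  and from N.\<close>

lemma word_rotates:
  assumes N: "N \<in> grassmannian l" "N' \<in> grassmannian l" and "0 < \<epsilon>"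
  shows "\<exists>w\<in>words. \<forall>h. norm (orthogonal_projection N' (foldr T w h)) \<le> norm (orthogonal_projection N h) + \<epsilon> * norm h"
proof -
  let ?G = "generate (BijGroup UNIV) (T ` I)"
  have "0 < \<epsilon> / 3" using \<open>0 < \<epsilon>\<close> by simp
  then obtain f f' where f: "f \<in> ?G" "grassmann_dist N (f ` M) < \<epsilon> / 3"
    and f': "f' \<in> ?G" "grassmann_dist N' (f' ` M) < \<epsilon> / 3"
    using orbit_approx N by meson
  note orth = generate_approx_word[OF f(1), THEN conjunct1] generate_approx_word[OF f'(1), THEN conjunct1]
  interpret group "BijGroup (UNIV :: 'a set)" by (rule group_BijGroup)
  have TB: "T ` I \<subseteq> carrier (BijGroup UNIV)"
    using orthogonal_T[THEN orthogonal_transformation_bij] by (auto simp: BijGroup_def)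
  have "f' \<otimes>\<^bsub>BijGroup UNIV\<^esub> inv\<^bsub>BijGroup UNIV\<^esub> f \<in> ?G"
    using f(1) f'(1) generate_m_inv_closed[OF TB] by (intro generate.eng) auto
  moreover have "f' \<otimes>\<^bsub>BijGroup UNIV\<^esub> inv\<^bsub>BijGroup UNIV\<^esub> f = f' \<circ> inv_into UNIV f"
    using orth by (simp add: inv_BijGroup_UNIV mult_BijGroup_UNIV orthogonal_transformation_bij orthogonal_transformation_inv)
  ultimately have "f' \<circ> inv_into UNIV f \<in> ?G" by simp
  from generate_approx_word[OF this, THEN conjunct2, rule_format, OF \<open>0 < \<epsilon> / 3\<close>]
  obtain w where w: "w \<in> words" "\<And>x. norm (f' (inv_into UNIV f x) - foldr T w x) \<le> \<epsilon> / 3 * norm x"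
    unfolding comp_apply by blast
  have sub: "subspace N" "subspace N'" "subspace (f ` M)" "subspace (f' ` M)" "subspace M"
    using N M grassmannian_image[OF orth(1) M] grassmannian_image[OF orth(2) M] by (auto simp: grassmannian_def)
  have "norm (orthogonal_projection N' (foldr T w h)) \<le> norm (orthogonal_projection N h) + \<epsilon> * norm h" for h
  proof -
    define q where "q = inv_into UNIV f h"
    have fq: "f q = h" using orthogonal_transformation_surj[OF orth(1)] by (simp add: q_def surj_f_inv_f)
    have nrm: "norm (f x) = norm x" "norm (f' x) = norm x" for x using orth by (auto simp: orthogonal_transformation)
    have "norm (orthogonal_projection N' (foldr T w h) - orthogonal_projection N' (f' q)) \<le> \<epsilon> / 3 * norm h"
      using norm_orthogonal_projection_le[OF sub(2), of "foldr T w h - f' q"] w(2)[of h]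
      by (simp add: linear_diff[OF linear_orthogonal_projection[OF sub(2)]] q_def norm_minus_commute)
    then have 1: "norm (orthogonal_projection N' (foldr T w h)) \<le> norm (orthogonal_projection N' (f' q)) + \<epsilon> / 3 * norm h"
      using norm_triangle_sub[of "orthogonal_projection N' (foldr T w h)" "orthogonal_projection N' (f' q)"] by linarith
    have 2: "norm (orthogonal_projection N' (f' q)) \<le> norm (orthogonal_projection (f' ` M) (f' q)) + \<epsilon> / 3 * norm h"
      using norm_orthogonal_projection_le_dist[OF sub(2,4), of "\<epsilon> / 3" "f' q"] f'(2) nrm fq by (metis less_imp_le)
    have 3: "norm (orthogonal_projection (f' ` M) (f' q)) = norm (orthogonal_projection (f ` M) h)"
      using orthogonal_projection_image[OF orth(1) sub(5), of q] orthogonal_projection_image[OF orth(2) sub(5), of q]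
        fq nrm by simp
    have "grassmann_dist (f ` M) N \<le> \<epsilon> / 3" using f(2) by (simp add: grassmann_dist_def norm_minus_commute)
    then have 4: "norm (orthogonal_projection (f ` M) h) \<le> norm (orthogonal_projection N h) + \<epsilon> / 3 * norm h"
      by (rule norm_orthogonal_projection_le_dist[OF sub(3,1)])
    show ?thesis using 1 2 3 4 by simp
  qed
  with w(1) show ?thesis by blast
qed

text \<open>A finite net of planes suffices as targets. Finiteness of Z gives the ratios of the
  rotating words a positive lower bound that is uniform in the target plane.\<close>

lemma finite_words_rotate:
  assumes N: "N \<in> grassmannian l" and "0 < \<delta>"
  shows "\<exists>Z\<subseteq>words. finite Z \<and> (\<forall>N'\<in>grassmannian l. \<exists>z\<in>Z.
    \<forall>h. norm (orthogonal_projection N' (foldr T z h)) \<le> norm (orthogonal_projection N h) + \<delta> * norm h)"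
proof -
  have "0 < \<delta> / 2" using \<open>0 < \<delta>\<close> by simp
  then obtain F where F: "finite F" "F \<subseteq> grassmannian l"
    "\<And>N' :: 'a set. N' \<in> grassmannian l \<Longrightarrow> \<exists>L\<in>F. grassmann_dist N' L < \<delta> / 2"
    using grassmannian_totally_bounded by meson
  have "\<forall>L\<in>F. \<exists>w\<in>words. \<forall>h. norm (orthogonal_projection L (foldr T w h)) \<le> norm (orthogonal_projection N h) + \<delta> / 2 * norm h"
    using word_rotates[OF N _ \<open>0 < \<delta> / 2\<close>] F(2) by blast
  then obtain z where z: "\<And>L. L \<in> F \<Longrightarrow> z L \<in> words"
    "\<And>L h. L \<in> F \<Longrightarrow> norm (orthogonal_projection L (foldr T (z L) h)) \<le> norm (orthogonal_projection N h) + \<delta> / 2 * norm h"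
    by metis
  have "\<exists>y\<in>z ` F. \<forall>h. norm (orthogonal_projection N' (foldr T y h)) \<le> norm (orthogonal_projection N h) + \<delta> * norm h"
    if N': "N' \<in> grassmannian l" for N'
  proof -
    obtain L where L: "L \<in> F" "grassmann_dist N' L < \<delta> / 2" using F(3)[OF N'] by blast
    have "norm (orthogonal_projection N' (foldr T (z L) h)) \<le> norm (orthogonal_projection N h) + \<delta> * norm h" for h
      using norm_orthogonal_projection_le_dist[of N' L "\<delta> / 2" "foldr T (z L) h"] z(1)[OF L(1)] z(2)[OF L(1), of h] L N' F(2)
      by (auto simp: grassmannian_subspace subset_iff)
    with L(1) show ?thesis by blast
  qed
  then show ?thesis using F(1) z(1) by (intro exI[of _ "z ` F"]) auto
qed

end

section \<open>Clusters of cylinders with nearly equal projections\<close>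

lemma funpow_intertwine:
  assumes "\<And>x. g (f x) = h (g x)" shows "g ((f ^^ k) x) = (h ^^ k) (g x)"
  by (induction k) (simp_all add: assms)

context self_similar_set
begin

definition rad :: real where "rad = (SOME D. 0 < D \<and> (\<forall>x\<in>K. norm x \<le> D))"

lemma rad_pos: "0 < rad" and norm_le_rad: "x \<in> K \<Longrightarrow> norm x \<le> rad"
proof -
  have "\<exists>D. 0 < D \<and> (\<forall>x\<in>K. norm x \<le> D)"
    using compact_imp_bounded[OF compact_K] unfolding bounded_pos by blast
  then have "0 < rad \<and> (\<forall>x\<in>K. norm x \<le> rad)" unfolding rad_def by (rule someI_ex)
  then show "0 < rad" and "x \<in> K \<Longrightarrow> norm x \<le> rad" by auto
qed

lemma norm_diff_centre_le:
  assumes "w \<in> words" "x \<in> cyl w" shows "norm (x - centre w) \<le> ratio w * rad"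
  using assms word_diff[OF assms(1), of _ 0] norm_le_rad ratio_pos[OF assms(1)] by auto

text \<open>A centre is the image of the origin, which need not lie in K. A point of the cylinder
  has norm at most \<open>rad\<close> and is within \<open>rad\<close> of the centre.\<close>

lemma norm_centre_le:
  assumes "w \<in> words" shows "norm (centre w) \<le> 2 * rad"
proof -
  obtain x where x: "x \<in> cyl w" using cyl_nonempty[of w] by blast
  have "norm (x - centre w) \<le> ratio w * rad" by (rule norm_diff_centre_le[OF assms x])
  also have "\<dots> \<le> 1 * rad" using ratio_le_1[OF assms] rad_pos by (intro mult_right_mono) auto
  finally have "norm (x - centre w) \<le> rad" by simp
  moreover have "norm x \<le> rad" using x cyl_subset[OF assms] norm_le_rad by blast
  ultimately show ?thesis using norm_triangle_ineq4[of x "x - centre w"] by simp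
qed

lemma exists_disjoint_cyls: "\<exists>a\<in>words. \<exists>b\<in>words. cyl a \<inter> cyl b = {}"
proof -
  obtain x y where xy: "x \<in> K" "y \<in> K" "x \<noteq> y" using nontrivial by blast
  \<comment> \<open>With \<open>s * rad\<close> at most an eighth of the distance, each of the two
    cylinders has diameter at most a quarter of it, so they cannot meet.\<close>
  define s where "s = min (1 / 2) (dist x y / (8 * rad))"
  have s: "0 < s" "s < 1" using xy(3) rad_pos by (auto simp: s_def)
  have sr: "s * rad \<le> dist x y / 8" using rad_pos by (simp add: s_def min_def field_simps)
  obtain a where a: "a \<in> words" "x \<in> cyl a" "ratio a \<le> s" using exists_word_of_ratio[OF xy(1) s] by blast
  obtain b where b: "b \<in> words" "y \<in> cyl b" "ratio b \<le> s" using exists_word_of_ratio[OF xy(2) s] by blast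
  have near: "dist p q \<le> dist x y / 4" if w: "w \<in> words" "ratio w \<le> s" "p \<in> cyl w" "q \<in> cyl w" for p q w
  proof -
    have "ratio w * rad \<le> dist x y / 8" using mult_right_mono[OF w(2), of rad] rad_pos sr by linarith
    then show ?thesis
      using norm_diff_centre_le[OF w(1,3)] norm_diff_centre_le[OF w(1,4)]
        norm_triangle_ineq4[of "p - centre w" "q - centre w"] by (simp add: dist_norm)
  qed
  have "cyl a \<inter> cyl b = {}"
  proof (rule ccontr)
    assume "cyl a \<inter> cyl b \<noteq> {}"
    then obtain p where p: "p \<in> cyl a" "p \<in> cyl b" by blast
    have "dist x y \<le> dist x p + dist p y" by (rule dist_triangle)
    also have "\<dots> \<le> dist x y / 4 + dist x y / 4" using near[OF a(1,3,2) p(1)] near[OF b(1,3) p(2) b(2)] by simp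
    finally show False using xy(3) by simp
  qed
  with a b show ?thesis by blast
qed

lemma ratio_concat_replicate: "ratio (concat (replicate k w)) = ratio w ^ k"
  by (induction k) simp_all

text \<open>The words \<open>(ab)\<^sup>k\<close> and \<open>(ba)\<^sup>k\<close> have equal ratios and conjugate rotations, so both rotations are
  close to the identity as soon as one of them is.\<close>

lemma exists_twin_words:
  assumes "0 < \<epsilon>"
  shows "\<exists>u\<in>words. \<exists>u'\<in>words. ratio u = ratio u' \<and> cyl u \<inter> cyl u' = {} \<and>
    (\<forall>x. norm (foldr T u x - x) \<le> \<epsilon> * norm x) \<and> (\<forall>x. norm (foldr T u' x - x) \<le> \<epsilon> * norm x)"
proof -
  obtain a b where ab: "a \<in> words" "b \<in> words" "cyl a \<inter> cyl b = {}" using exists_disjoint_cyls by blast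
  have "orthogonal_transformation (foldr T (a @ b))" using ab by (intro orthogonal_word) simp
  from orthogonal_transformation_recurrent[OF this assms]
  obtain k where k: "0 < k" "\<And>x. norm ((foldr T (a @ b) ^^ k) x - x) \<le> \<epsilon> * norm x" by blast
  have rep: "concat (replicate k w) \<in> words" if "w \<in> words" for w k
    using that by (induction k) auto
  have sub: "cyl (concat (replicate k (p @ q))) \<subseteq> cyl p" if "p \<in> words" "q \<in> words" for p q
  proof -
    have "concat (replicate k (p @ q)) = p @ q @ concat (replicate (k - 1) (p @ q))"
      using k(1) by (cases k) auto
    moreover have "q @ concat (replicate (k - 1) (p @ q)) \<in> words" using that by (simp add: rep)
    ultimately show ?thesis using cyl_append_subset by metis
  qed
  have "norm (foldr T (concat (replicate k (b @ a))) x - x) \<le> \<epsilon> * norm x" for x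
  proof -
    have "surj (foldr T b)" using ab(2) by (intro orthogonal_transformation_surj orthogonal_word)
    then obtain y where y: "x = foldr T b y" by blast
    have "foldr T (concat (replicate k (b @ a))) x = foldr T b ((foldr T (a @ b) ^^ k) y)"
      unfolding foldr_concat_replicate y by (rule funpow_intertwine[symmetric]) simp
    then have "norm (foldr T (concat (replicate k (b @ a))) x - x) = norm ((foldr T (a @ b) ^^ k) y - y)"
      using ab(2) linear_diff[OF linear_word[OF ab(2)], of "(foldr T (a @ b) ^^ k) y" y] norm_word[OF ab(2)]
      unfolding y by metis
    also have "\<dots> \<le> \<epsilon> * norm x" using k(2)[of y] ab(2) by (simp add: y)
    finally show ?thesis .
  qed
  moreover have "cyl (concat (replicate k (a @ b))) \<inter> cyl (concat (replicate k (b @ a))) = {}"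
    using sub[OF ab(1,2)] sub[OF ab(2,1)] ab(3) by blast
  moreover have "ratio (concat (replicate k (a @ b))) = ratio (concat (replicate k (b @ a)))"
    by (simp add: ratio_concat_replicate mult.commute)
  moreover have "norm (foldr T (concat (replicate k (a @ b))) x - x) \<le> \<epsilon> * norm x" for x
    unfolding foldr_concat_replicate by (rule k(2))
  moreover have "concat (replicate k (a @ b)) \<in> words" "concat (replicate k (b @ a)) \<in> words"
    using ab by (simp_all add: rep)
  ultimately show ?thesis by blast
qed

lemma disj_append:
  assumes "w \<in> words" "disj F" shows "disj ((@) w ` F)"
proof -
  have "cyl (w @ x) \<inter> cyl (w @ y) = {}" if "cyl x \<inter> cyl y = {}" for x y
    unfolding cyl_append using that inj_word[OF assms(1)] by (simp add: image_Int[symmetric])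
  then show ?thesis using assms by (auto simp: disj_def disjoint_family_on_def simp del: foldr_append)
qed

lemma disj_Un:
  assumes "disj F" "disj G" "\<And>x y. x \<in> F \<Longrightarrow> y \<in> G \<Longrightarrow> cyl x \<inter> cyl y = {}"
  shows "disj (F \<union> G)" "F \<inter> G = {}"
proof -
  show "disj (F \<union> G)" using assms unfolding disj_def disjoint_family_on_def by (simp add: ball_Un) blast
  show "F \<inter> G = {}" using assms(3) cyl_nonempty by fastforce
qed

end

section \<open>Doubling clusters\<close>

context dense_self_similar_set
begin

text \<open>The strict inequality leaves a positive slack below R, as W is finite. Doubling spends
  part of that slack on approximation errors and restores strictness at the new scale.\<close>

definition cluster :: "nat \<Rightarrow> 'i list set \<Rightarrow> 'a set \<Rightarrow> real \<Rightarrow> bool" where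
  "cluster n W N R \<longleftrightarrow> disj W \<and> card W = n \<and> N \<in> grassmannian l \<and> (\<forall>w\<in>W. ratio w = R) \<and>
    (\<forall>x\<in>W. \<forall>y\<in>W. norm (orthogonal_projection N (centre x - centre y)) < R)"

text \<open>A common prefix preserves the relative position of two cylinders. Hence a cluster can be rotated
  into the plane orthogonal to the displacement of two disjoint twin cylinders, which are chosen after the
  words needed for that rotation.\<close>

lemma cluster_double:
  assumes "cluster n W N R" "0 < n"
  shows "\<exists>W' N' R'. cluster (2 * n) W' N' R'"
proof -
  let ?P = orthogonal_projection
  have W: "disj W" "card W = n" and N: "N \<in> grassmannian l" and ratio: "\<And>w. w \<in> W \<Longrightarrow> ratio w = R"
    and close: "\<And>x y. x \<in> W \<Longrightarrow> y \<in> W \<Longrightarrow> norm (?P N (centre x - centre y)) < R"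
    using assms by (auto simp: cluster_def)
  have finW: "finite W" and words: "\<And>w. w \<in> W \<Longrightarrow> w \<in> words" using W by (auto simp: disj_def)
  have "W \<noteq> {}" using W(2) \<open>0 < n\<close> by auto
  \<comment> \<open>\<mu> is the largest projected distance in the cluster and \<sigma> the slack;
    each of the two approximations below may use a quarter of \<sigma>.\<close>
  define \<mu> where "\<mu> = Max ((\<lambda>(x, y). norm (?P N (centre x - centre y))) ` (W \<times> W))"
  have "\<mu> < R" unfolding \<mu>_def using finW \<open>W \<noteq> {}\<close> close by (subst Max_less_iff) auto
  have \<mu>: "norm (?P N (centre x - centre y)) \<le> \<mu>" if "x \<in> W" "y \<in> W" for x y
    unfolding \<mu>_def using finW that by (intro Max_ge) (auto intro!: image_eqI[of _ _ "(x, y)"])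
  define \<sigma> where "\<sigma> = R - \<mu>"
  have \<sigma>: "0 < \<sigma>" using \<open>\<mu> < R\<close> by (simp add: \<sigma>_def)
  \<comment> \<open>Two centres are at most \<open>4 * rad\<close> apart, so rotating the cluster
    costs at most \<sigma> / 4.\<close>
  define \<delta> where "\<delta> = \<sigma> / (16 * rad)"
  have \<delta>: "0 < \<delta>" "\<delta> * (4 * rad) = \<sigma> / 4" using \<sigma> rad_pos by (auto simp: \<delta>_def)
  obtain Z where Z: "Z \<subseteq> words" "finite Z"
    "\<And>N'. N' \<in> grassmannian l \<Longrightarrow> \<exists>z\<in>Z. \<forall>h. norm (?P N' (foldr T z h)) \<le> norm (?P N h) + \<delta> * norm h"
    using finite_words_rotate[OF N \<delta>(1)] by blast
  have "Z \<noteq> {}" using Z(3)[OF N] by auto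
  define \<rho> where "\<rho> = Min ((\<lambda>z. ratio z) ` Z)"
  have \<rho>: "0 < \<rho>" unfolding \<rho>_def using Z \<open>Z \<noteq> {}\<close> ratio_pos by (subst Min_gr_iff) auto
  \<comment> \<open>The deviation of the twin rotations from the identity acts on vectors of norm at
    most \<open>2 * rad\<close>, twice, so it costs \<rho> \<sigma> / 4. The factor \<rho> is there
    because the cluster has by then been shrunk by \<open>ratio z\<close>, which is at least
    \<rho>.\<close>
  define \<epsilon> where "\<epsilon> = \<rho> * \<sigma> / (16 * rad)"
  have \<epsilon>: "0 < \<epsilon>" "\<epsilon> * (4 * rad) = \<rho> * \<sigma> / 4" using \<sigma> \<rho> rad_pos by (auto simp: \<epsilon>_def)
  obtain u u' where u: "u \<in> words" "u' \<in> words" "ratio u = ratio u'" "cyl u \<inter> cyl u' = {}"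
    "\<And>x. norm (foldr T u x - x) \<le> \<epsilon> * norm x" "\<And>x. norm (foldr T u' x - x) \<le> \<epsilon> * norm x"
    using exists_twin_words[OF \<epsilon>(1)] by blast
  \<comment> \<open>This plane depends on the twins, which were chosen after Z; hence Z had to serve
    every plane at once.\<close>
  obtain N' where N': "N' \<in> grassmannian l" "?P N' (centre u - centre u') = 0"
    using exists_grassmannian_projecting_to_0[OF l_less] by blast
  have lin: "linear (?P N')" using N'(1) by (intro linear_orthogonal_projection grassmannian_subspace)
  obtain z where z: "z \<in> Z" "\<And>h. norm (?P N' (foldr T z h)) \<le> norm (?P N h) + \<delta> * norm h"
    using Z(3)[OF N'(1)] by blast
  have zw: "z \<in> words" "\<rho> \<le> ratio z" using z Z by (auto simp: \<rho>_def)
  define R' where "R' = ratio u * ratio z * R"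
  have bound: "norm (?P N' (centre (p @ z @ x) - centre (q @ z @ y))) < R'"
    if pq: "p \<in> {u, u'}" "q \<in> {u, u'}" and xy: "x \<in> W" "y \<in> W" for p q x y
  proof -
    define a b where "a = centre (z @ x)" and "b = centre (z @ y)"
    have nab: "norm a \<le> 2 * rad" "norm b \<le> 2 * rad"
      unfolding a_def b_def using zw words xy by (auto intro!: norm_centre_le simp del: foldr_append)
    have pos: "0 < ratio u" "0 < ratio z" using u zw ratio_pos by auto
    have "?P N' (centre p - centre q) = 0"
      using pq N'(2) linear_neg[OF lin, of "centre u - centre u'"] linear_0[OF lin] by auto
    \<comment> \<open>The difference of the prefix centres is 0 or plus or minus the vector killed
      by the projection to N'. What remains differs from a - b by the deviation of the twin
      rotations from the identity.\<close>
    moreover have "centre (p @ z @ x) - centre (q @ z @ y) =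
        (centre p - centre q) + ratio u *\<^sub>R (foldr T p a - foldr T q b)"
      using pq u word_eq[of p a] word_eq[of q b] by (auto simp: a_def b_def algebra_simps)
    ultimately have 1: "norm (?P N' (centre (p @ z @ x) - centre (q @ z @ y))) =
        ratio u * norm (?P N' (foldr T p a - foldr T q b))"
      using pos by (simp add: linear_add[OF lin] linear_cmul[OF lin])
    have "norm ((foldr T p a - a) - (foldr T q b - b)) \<le> \<epsilon> * (2 * rad) + \<epsilon> * (2 * rad)"
    proof (rule order_trans[OF norm_triangle_ineq4 add_mono])
      have "norm (foldr T p a - a) \<le> \<epsilon> * norm a" "norm (foldr T q b - b) \<le> \<epsilon> * norm b"
        using pq u(5,6) by auto
      then show "norm (foldr T p a - a) \<le> \<epsilon> * (2 * rad)" "norm (foldr T q b - b) \<le> \<epsilon> * (2 * rad)"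
        using nab \<epsilon>(1) by (meson less_imp_le mult_left_mono order_trans)+
    qed
    then have "norm (?P N' ((foldr T p a - a) - (foldr T q b - b))) \<le> \<rho> * \<sigma> / 4"
      using norm_orthogonal_projection_le[OF grassmannian_subspace[OF N'(1)], of "(foldr T p a - a) - (foldr T q b - b)"] \<epsilon>(2)
      by linarith
    moreover have "foldr T p a - foldr T q b = (a - b) + ((foldr T p a - a) - (foldr T q b - b))" by simp
    ultimately have 2: "norm (?P N' (foldr T p a - foldr T q b)) \<le> norm (?P N' (a - b)) + \<rho> * \<sigma> / 4"
      using norm_triangle_ineq[of "?P N' (a - b)" "?P N' ((foldr T p a - a) - (foldr T q b - b))"]
      by (simp add: linear_add[OF lin, symmetric])
    have "a - b = ratio z *\<^sub>R foldr T z (centre x - centre y)"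
      unfolding a_def b_def using word_diff[OF zw(1)] by simp
    then have 3: "norm (?P N' (a - b)) = ratio z * norm (?P N' (foldr T z (centre x - centre y)))"
      using pos by (simp add: linear_cmul[OF lin])
    have "norm (centre x - centre y) \<le> 4 * rad"
      using norm_centre_le[OF words[OF xy(1)]] norm_centre_le[OF words[OF xy(2)]]
        norm_triangle_ineq4[of "centre x" "centre y"] by linarith
    then have "\<delta> * norm (centre x - centre y) \<le> \<sigma> / 4"
      using \<delta> mult_left_mono[of "norm (centre x - centre y)" "4 * rad" \<delta>] by linarith
    then have "norm (?P N' (foldr T z (centre x - centre y))) \<le> \<mu> + \<sigma> / 4"
      using z(2)[of "centre x - centre y"] \<mu>[OF xy] by linarith
    then have "ratio z * norm (?P N' (foldr T z (centre x - centre y))) \<le> ratio z * (\<mu> + \<sigma> / 4)"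
      using pos by (intro mult_left_mono) auto
    moreover have "\<rho> * \<sigma> / 4 \<le> ratio z * (\<sigma> / 4)" using zw(2) \<sigma> by simp
    ultimately have "norm (?P N' (foldr T p a - foldr T q b)) \<le> ratio z * (\<mu> + \<sigma> / 2)"
      using 2 3 by (simp add: algebra_simps)
    also have "\<dots> < ratio z * R" using pos \<sigma> by (intro mult_strict_left_mono) (auto simp: \<sigma>_def field_simps)
    finally have "norm (?P N' (foldr T p a - foldr T q b)) < ratio z * R" .
    then show ?thesis unfolding 1 R'_def using pos by (simp add: mult.assoc)
  qed
  define W1 W2 where "W1 = (@) (u @ z) ` W" and "W2 = (@) (u' @ z) ` W"
  have disj: "disj W1" "disj W2" unfolding W1_def W2_def using u(1,2) zw(1) W(1) by (intro disj_append; simp)+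
  have cross: "cyl x \<inter> cyl y = {}" if x: "x \<in> W1" and y: "y \<in> W2" for x y
  proof -
    obtain x' y' where "x' \<in> W" "x = u @ z @ x'" "y' \<in> W" "y = u' @ z @ y'"
      using x y by (auto simp: W1_def W2_def)
    then have "cyl x \<subseteq> cyl u" "cyl y \<subseteq> cyl u'"
      using cyl_append_subset[of "z @ x'" u] cyl_append_subset[of "z @ y'" u'] zw words by simp_all
    with u(4) show ?thesis by blast
  qed
  have "card W1 = n" "card W2 = n" unfolding W1_def W2_def using W(2) by (auto intro!: card_image inj_onI)
  then have "card (W1 \<union> W2) = 2 * n"
    using disj_Un(2)[OF disj cross] disj by (subst card_Un_disjoint) (auto simp: disj_def)
  moreover have "ratio w = R'" if "w \<in> W1 \<union> W2" for w
    using that ratio u(3) by (auto simp: W1_def W2_def R'_def)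
  moreover have "norm (?P N' (centre x - centre y)) < R'" if xy: "x \<in> W1 \<union> W2" "y \<in> W1 \<union> W2" for x y
  proof -
    have "\<exists>p x'. p \<in> {u, u'} \<and> x' \<in> W \<and> w = p @ z @ x'" if "w \<in> W1 \<union> W2" for w
      using that by (auto simp: W1_def W2_def)
    then show ?thesis using bound xy by metis
  qed
  ultimately have "cluster (2 * n) (W1 \<union> W2) N' R'"
    unfolding cluster_def using disj_Un(1)[OF disj cross] N'(1) by blast
  then show ?thesis by blast
qed

lemma exists_cluster: "\<exists>W N R. cluster (2 ^ n) W N R"
proof (induction n)
  case 0
  have "disj {[]}" by (simp add: disj_def disjoint_family_on_def)
  then have "cluster 1 {[]} M 1"
    using M linear_0[OF linear_orthogonal_projection[OF grassmannian_subspace[OF M]]] by (simp add: cluster_def)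
  then show ?case by auto
next
  case (Suc n)
  then show ?case using cluster_double by (metis pos2 power_Suc zero_less_power)
qed

end

section \<open>Images under maps of low rank\<close>

text \<open>A Lebesgue number of a cover by balls on which g' varies little serves all x in K. On
  the convex ball around x the mean value inequality is applied to g minus its derivative at x, so p
  and q may be any points of that ball.\<close>

lemma uniformly_differentiable_on_compact:
  fixes g :: "'a::euclidean_space \<Rightarrow> 'b::real_normed_vector"
  assumes "compact K" "open U" "K \<subseteq> U"
    and deriv: "\<And>x. x \<in> U \<Longrightarrow> (g has_derivative blinfun_apply (g' x)) (at x)"
    and cont: "continuous_on U g'" and "0 < \<omega>"
  shows "\<exists>\<eta>>0. \<forall>x\<in>K. \<forall>p\<in>ball x \<eta>. \<forall>q\<in>ball x \<eta>. norm (g p - g q - blinfun_apply (g' x) (p - q)) \<le> \<omega> * norm (p - q)"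
proof -
  have "\<exists>d>0. \<forall>y\<in>ball x d. y \<in> U \<and> dist (g' y) (g' x) \<le> \<omega> / 2" if "x \<in> K" for x
  proof -
    have x: "x \<in> U" using that assms by auto
    then obtain d1 where d1: "0 < d1" "ball x d1 \<subseteq> U" using \<open>open U\<close> open_contains_ball by blast
    obtain d2 where d2: "0 < d2" "\<And>y. y \<in> U \<Longrightarrow> dist y x < d2 \<Longrightarrow> dist (g' y) (g' x) < \<omega> / 2"
      using cont x \<open>0 < \<omega>\<close> unfolding continuous_on_iff by (meson half_gt_zero)
    show ?thesis
      using d1 d2 by (intro exI[of _ "min d1 d2"]) (auto simp: dist_commute subset_iff less_imp_le)
  qed
  then obtain d where d: "\<And>x. x \<in> K \<Longrightarrow> 0 < d x"
    "\<And>x y. x \<in> K \<Longrightarrow> y \<in> ball x (d x) \<Longrightarrow> y \<in> U \<and> dist (g' y) (g' x) \<le> \<omega> / 2" by metis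
  have "K \<subseteq> \<Union> ((\<lambda>x. ball x (d x)) ` K)" using d(1) by force
  then obtain \<eta> where \<eta>: "0 < \<eta>" "\<And>x. x \<in> K \<Longrightarrow> \<exists>G\<in>(\<lambda>x. ball x (d x)) ` K. ball x \<eta> \<subseteq> G"
    using Heine_Borel_lemma[OF \<open>compact K\<close>, of "(\<lambda>x. ball x (d x)) ` K"] by blast
  have "norm (g p - g q - blinfun_apply (g' x) (p - q)) \<le> \<omega> * norm (p - q)"
    if x: "x \<in> K" and p: "p \<in> ball x \<eta>" and q: "q \<in> ball x \<eta>" for x p q
  proof -
    obtain x0 where x0: "x0 \<in> K" "ball x \<eta> \<subseteq> ball x0 (d x0)" using \<eta>(2)[OF x] by blast
    have near: "y \<in> U" "norm (g' y - g' x) \<le> \<omega>" if "y \<in> ball x \<eta>" for y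
    proof -
      have "y \<in> ball x0 (d x0)" "x \<in> ball x0 (d x0)"
        using subsetD[OF x0(2)] that \<eta>(1) by simp_all
      with d(2)[OF x0(1)] have "y \<in> U" "dist (g' y) (g' x0) \<le> \<omega> / 2" "dist (g' x) (g' x0) \<le> \<omega> / 2" by auto
      then show "y \<in> U" "norm (g' y - g' x) \<le> \<omega>"
        using dist_triangle2[of "g' y" "g' x" "g' x0"] by (auto simp: dist_norm)
    qed
    have "norm ((g p - blinfun_apply (g' x) p) - (g q - blinfun_apply (g' x) q)) \<le> \<omega> * norm (p - q)"
    proof (rule differentiable_bound[OF convex_ball[of x \<eta>] _ _ p q])
      fix y assume y: "y \<in> ball x \<eta>"
      show "((\<lambda>y. g y - blinfun_apply (g' x) y) has_derivative blinfun_apply (g' y - g' x)) (at y within ball x \<eta>)"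
        using deriv[OF near(1)[OF y], THEN has_derivative_at_withinI, of "ball x \<eta>"]
        by (auto intro!: derivative_eq_intros simp: blinfun.diff_left blinfun.zero_left fun_eq_iff)
      show "onorm (blinfun_apply (g' y - g' x)) \<le> \<omega>"
        using near(2)[OF y] by (simp add: norm_blinfun.rep_eq)
    qed
    then show ?thesis by (simp add: blinfun.diff_right algebra_simps)
  qed
  with \<eta>(1) show ?thesis by blast
qed

section \<open>Enlarged cylinders and maximal disjoint families\<close>

context self_similar_set
begin

text \<open>The constant comes from maximality: a cylinder of ratio at most s has diameter at most
  \<open>2 * rad * s\<close>, and if it meets a cylinder w of ratio at least
  \<open>rmin * s\<close>, it lies within \<open>2 * rad / rmin * ratio w\<close> of it.\<close>

definition near :: "'i list \<Rightarrow> 'a set" where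
  "near w = {x\<in>K. \<exists>y\<in>cyl w. dist x y \<le> 2 * rad / rmin * ratio w}"

lemma near_subset: "near w \<subseteq> K"
  by (auto simp: near_def)

lemma norm_near_centre_le:
  assumes "w \<in> words" "x \<in> near w"
  shows "norm (x - centre w) \<le> (2 * rad / rmin + rad) * ratio w"
proof -
  obtain y where "y \<in> cyl w" "dist x y \<le> 2 * rad / rmin * ratio w" using assms by (auto simp: near_def)
  then show ?thesis
    using norm_diff_centre_le[OF assms(1), of y] norm_triangle_ineq[of "x - y" "y - centre w"]
    by (simp add: dist_norm algebra_simps)
qed

lemma disj_subset: "disj F \<Longrightarrow> G \<subseteq> F \<Longrightarrow> disj G"
  by (auto simp: disj_def intro: finite_subset disjoint_family_on_mono)

text \<open>In dimension 0 every cylinder has content 1, so two disjoint ones would exceed the bound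
  1.\<close>

lemma hausdorff_dim_pos: "0 < hausdorff_dim K"
proof (rule ccontr)
  assume "\<not> 0 < hausdorff_dim K"
  then have 0: "hausdorff_dim K = 0" using hausdorff_dim_nonneg by simp
  obtain a b where ab: "a \<in> words" "b \<in> words" "cyl a \<inter> cyl b = {}" using exists_disjoint_cyls by blast
  then have "a \<noteq> b" using cyl_nonempty[of a] by auto
  have "disj {a, b}" using ab by (auto simp: disj_def disjoint_family_on_def Int_commute)
  then have "content {a, b} \<le> 1" by (rule disjoint_cyl_content_le_1)
  then show False using \<open>a \<noteq> b\<close> 0 ratio_pos[OF ab(1)] ratio_pos[OF ab(2)] by simp
qed

text \<open>Candidates are the words with ratio in (\<open>rmin * s\<close>, s], which are finite in
  number. Each point of K lies in a candidate cylinder, and by maximality that cylinder meets a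
  chosen one. Members of F0 have ratio at least s, so their enlargements also reach far
  enough.\<close>

lemma exists_maximal_disj:
  assumes F0: "disj F0" and s: "0 < s" "s < 1" "\<And>w. w \<in> F0 \<Longrightarrow> s \<le> ratio w"
  shows "\<exists>F. disj (F0 \<union> F) \<and> F0 \<inter> F = {} \<and> (\<forall>w\<in>F. ratio w \<le> s) \<and> K \<subseteq> (\<Union>w\<in>F0 \<union> F. near w)"
proof -
  define A where "A = {w\<in>words. rmin * s < ratio w \<and> ratio w \<le> s}"
  have finA: "finite A"
    using finite_words_ratio_gt[of "rmin * s"] rmin_pos s(1) by (auto simp: A_def elim: rev_finite_subset)
  define \<F> where "\<F> = {F. F \<subseteq> A - F0 \<and> disj (F0 \<union> F)}"
  have "finite \<F>" using finA by (auto simp: \<F>_def intro: finite_subset[of _ "Pow A"])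
  moreover have "{} \<in> \<F>" using F0 by (simp add: \<F>_def)
  ultimately obtain F where F: "F \<in> \<F>" and max: "\<And>G. G \<in> \<F> \<Longrightarrow> F \<subseteq> G \<Longrightarrow> G = F"
    using finite_has_maximal[of \<F>] by blast
  have disj: "disj (F0 \<union> F)" and FA: "F \<subseteq> A - F0" using F by (auto simp: \<F>_def)
  have "x \<in> (\<Union>w\<in>F0 \<union> F. near w)" if x: "x \<in> K" for x
  proof -
    obtain w where w: "w \<in> words" "x \<in> cyl w" "rmin * s < ratio w" "ratio w \<le> s"
      using exists_word_of_ratio[OF x s(1,2)] by blast
    have "\<exists>f\<in>F0 \<union> F. cyl w \<inter> cyl f \<noteq> {}"
    proof (rule ccontr)
      assume non: "\<not> ?thesis"
      then have "w \<notin> F0 \<union> F" using cyl_nonempty[of w] by blast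
      have "disj {w}" using w by (simp add: disj_def disjoint_family_on_def)
      then have "disj ((F0 \<union> F) \<union> {w})" using non by (intro disj_Un(1) disj) (auto simp: Int_commute)
      then have "insert w F \<in> \<F>" using w FA \<open>w \<notin> F0 \<union> F\<close> by (auto simp: \<F>_def A_def)
      from max[OF this] \<open>w \<notin> F0 \<union> F\<close> show False by blast
    qed
    then obtain f y where f: "f \<in> F0 \<union> F" and y: "y \<in> cyl w" "y \<in> cyl f" by blast
    have "rmin * s \<le> ratio f"
    proof (cases "f \<in> F0")
      case True
      have "rmin * s \<le> 1 * s" using rmin_lt_1 s by (intro mult_right_mono) auto
      with s(3)[OF True] show ?thesis by simp
    next
      case False
      then show ?thesis using f FA by (auto simp: A_def)
    qed
    then have "s \<le> ratio f / rmin" using rmin_pos by (simp add: field_simps)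
    then have "2 * rad * s \<le> 2 * rad / rmin * ratio f"
      using rad_pos mult_left_mono[of s "ratio f / rmin" "2 * rad"] by simp
    moreover have "ratio w * rad \<le> s * rad" using w(4) rad_pos by simp
    then have "dist x y \<le> 2 * (s * rad)"
      using norm_diff_centre_le[OF w(1,2)] norm_diff_centre_le[OF w(1) y(1)]
        dist_triangle2[of x y "centre w"] unfolding dist_norm by linarith
    then have "dist x y \<le> 2 * rad * s" by (simp add: mult_ac)
    ultimately have "dist x y \<le> 2 * rad / rmin * ratio f" by simp
    then have "x \<in> near f" unfolding near_def using x y(2) by blast
    with f show ?thesis by blast
  qed
  then have "K \<subseteq> (\<Union>w\<in>F0 \<union> F. near w)" by (rule subsetI)
  with disj FA show ?thesis unfolding A_def by blast
qed

end

section \<open>Clusters under a map of low rank\<close>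

locale dense_self_similar_map = dense_self_similar_set I S T r v K l M
  for I :: "'i set" and S T :: "'i \<Rightarrow> 'a::euclidean_space \<Rightarrow> 'a"
    and r :: "'i \<Rightarrow> real" and v :: "'i \<Rightarrow> 'a" and K :: "'a set" and l :: nat and M :: "'a set" +
  fixes U :: "'a set" and g :: "'a \<Rightarrow> 'b::real_normed_vector" and g' :: "'a \<Rightarrow> 'a \<Rightarrow>\<^sub>L 'b"
  assumes open_U: "open U" and K_U: "K \<subseteq> U"
    and deriv: "\<And>x. x \<in> U \<Longrightarrow> (g has_derivative blinfun_apply (g' x)) (at x)"
    and cont: "continuous_on U g'"
    and factor: "\<And>x. x \<in> K \<Longrightarrow> \<exists>N\<in>grassmannian l. \<forall>h. g' x h = g' x (orthogonal_projection N h)"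
begin

lemma uniformly_differentiable:
  assumes "0 < \<omega>"
  obtains \<eta> where "0 < \<eta>" "\<And>x p q. x \<in> K \<Longrightarrow> norm (p - x) < \<eta> \<Longrightarrow> norm (q - x) < \<eta> \<Longrightarrow>
    norm (g p - g q - g' x (p - q)) \<le> \<omega> * norm (p - q)"
  using uniformly_differentiable_on_compact[OF compact_K open_U K_U deriv cont assms]
  by (auto simp: dist_norm norm_minus_commute)

lemma derivative_bounded: obtains L where "1 \<le> L" "\<And>x. x \<in> K \<Longrightarrow> norm (g' x) \<le> L"
proof -
  have "bounded (g' ` K)"
    by (intro compact_imp_bounded compact_continuous_image compact_K continuous_on_subset[OF cont K_U])
  then obtain B where "\<And>x. x \<in> K \<Longrightarrow> norm (g' x) \<le> B" unfolding bounded_iff by blast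
  then show ?thesis by (intro that[of "max 1 B"]) (auto simp: le_max_iff_disj)
qed

text \<open>This prices what the clusters miss, which is covered by single enlarged cylinders. At
  scales where linearisation with error 1 is valid, g has Lipschitz constant \<open>L + 1\<close> on
  \<open>near w\<close>.\<close>

lemma dist_image_near_le:
  obtains C r0 where "0 < C" "0 < r0"
    "\<And>w p q. w \<in> words \<Longrightarrow> ratio w \<le> r0 \<Longrightarrow> p \<in> near w \<Longrightarrow> q \<in> near w \<Longrightarrow> dist (g p) (g q) \<le> C * ratio w"
proof -
  obtain L where L: "1 \<le> L" "\<And>x. x \<in> K \<Longrightarrow> norm (g' x) \<le> L" using derivative_bounded by blast
  obtain \<eta> where \<eta>: "0 < \<eta>" "\<And>x p q. x \<in> K \<Longrightarrow> norm (p - x) < \<eta> \<Longrightarrow> norm (q - x) < \<eta> \<Longrightarrow>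
    norm (g p - g q - g' x (p - q)) \<le> 1 * norm (p - q)" using uniformly_differentiable[OF zero_less_one] by blast
  define B where "B = 2 * rad / rmin + rad"
  have B: "0 < B" using rad_pos rmin_pos by (simp add: B_def add_pos_pos)
  show ?thesis
  proof (rule that)
    show "0 < (L + 1) * (2 * B)" "0 < \<eta> / (4 * B)" using L B \<eta> by auto
    fix w p q assume w: "w \<in> words" "ratio w \<le> \<eta> / (4 * B)" and pq: "p \<in> near w" "q \<in> near w"
    have "p \<in> K" using pq near_subset by blast
    have "norm (p - q) \<le> 2 * (B * ratio w)"
      using norm_near_centre_le[OF w(1) pq(1)] norm_near_centre_le[OF w(1) pq(2)]
        dist_triangle2[of p q "centre w"] unfolding dist_norm B_def by linarith
    then have "norm (p - q) \<le> 2 * B * ratio w" by (simp add: mult.assoc)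
    moreover have "2 * B * ratio w < \<eta>" using w(2) B \<eta>(1) by (simp add: field_simps)
    ultimately have "norm (q - p) < \<eta>" by (simp add: norm_minus_commute)
    then have "norm (g p - g q - g' p (p - q)) \<le> norm (p - q)"
      using \<eta>(2)[OF \<open>p \<in> K\<close>, of p q] \<eta>(1) by simp
    moreover have "norm (g' p (p - q)) \<le> L * norm (p - q)"
      using norm_blinfun[of "g' p" "p - q"] mult_right_mono[OF L(2)[OF \<open>p \<in> K\<close>], of "norm (p - q)"] by simp
    ultimately have "dist (g p) (g q) \<le> (L + 1) * norm (p - q)"
      using norm_triangle_sub[of "g p - g q" "g' p (p - q)"] by (simp add: dist_norm algebra_simps)
    also have "\<dots> \<le> (L + 1) * (2 * B * ratio w)"
      using \<open>norm (p - q) \<le> 2 * B * ratio w\<close> L(1) by (intro mult_left_mono) auto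
    finally show "dist (g p) (g q) \<le> (L + 1) * (2 * B) * ratio w" by (simp add: mult.assoc)
  qed
qed

text \<open>Such a Q contributes n s^t to the content, while its image can be covered at cost (C
  s)^t.\<close>

definition concentrated :: "nat \<Rightarrow> real \<Rightarrow> 'i list set \<Rightarrow> real \<Rightarrow> bool" where
  "concentrated n C Q s \<longleftrightarrow> disj Q \<and> card Q = n \<and> 0 < s \<and> (\<forall>x\<in>Q. ratio x = s) \<and>
    (\<forall>p\<in>\<Union>(near ` Q). \<forall>q\<in>\<Union>(near ` Q). dist (g p) (g q) \<le> C * s)"

text \<open>C is fixed before n, whereas \<theta> and r0 may depend on n. Inside a small cylinder g
  is nearly linear and its derivative sees just the projection to an l-plane, so a cluster rotated
  to fit that plane has an image of the size of one of its members.\<close>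

lemma exists_concentrated:
  obtains C where "0 < C" "\<And>n. \<exists>\<theta>>0. \<exists>r0>0. \<forall>w\<in>words. ratio w \<le> r0 \<longrightarrow>
    (\<exists>Q s. concentrated (2 ^ n) C Q s \<and> (\<forall>x\<in>Q. cyl x \<subseteq> cyl w) \<and> \<theta> * ratio w \<le> s \<and> s \<le> ratio w)"
proof -
  let ?P = orthogonal_projection
  obtain L where L: "1 \<le> L" "\<And>x. x \<in> K \<Longrightarrow> norm (g' x) \<le> L" using derivative_bounded by blast
  define E where "E = 2 * rad / rmin"
  have E: "0 < E" using rad_pos rmin_pos by (simp add: E_def)
  \<comment> \<open>Of the summands, 2 bounds the projected distance of two centres,
    \<open>2 * (E + rad)\<close> the distances of points to their centres, and 1 the error of
    linearisation, all in units of s.\<close>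
  define C where "C = L * (2 + 2 * (E + rad)) + 1"
  have C: "0 < C" using L E rad_pos by (simp add: C_def add_nonneg_pos)
  have "\<exists>\<theta>>0. \<exists>r0>0. \<forall>w\<in>words. ratio w \<le> r0 \<longrightarrow>
    (\<exists>Q s. concentrated (2 ^ n) C Q s \<and> (\<forall>x\<in>Q. cyl x \<subseteq> cyl w) \<and> \<theta> * ratio w \<le> s \<and> s \<le> ratio w)" for n
  proof -
    obtain W N R where cl: "cluster (2 ^ n) W N R" using exists_cluster by blast
    then have W: "disj W" "card W = 2 ^ n" and N: "N \<in> grassmannian l" and ratioW: "\<And>w. w \<in> W \<Longrightarrow> ratio w = R"
      and close: "\<And>x y. x \<in> W \<Longrightarrow> y \<in> W \<Longrightarrow> norm (?P N (centre x - centre y)) < R"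
      by (auto simp: cluster_def)
    have words: "\<And>w. w \<in> W \<Longrightarrow> w \<in> words" using W by (auto simp: disj_def)
    obtain x0 where x0: "x0 \<in> W" using W(2) by (metis all_not_in_conv card.empty power_not_zero zero_neq_numeral)
    have R: "0 < R" "R \<le> 1" using ratio_pos ratio_le_1 words[OF x0] ratioW[OF x0] by metis+
    \<comment> \<open>Centres are at most \<open>4 * rad\<close> apart, so the rotation adds at most
      R to projected distances already below R.\<close>
    define \<delta> where "\<delta> = R / (4 * rad)"
    have \<delta>: "0 < \<delta>" "\<delta> * (4 * rad) = R" using R rad_pos by (auto simp: \<delta>_def)
    obtain Z where Z: "Z \<subseteq> words" "finite Z"
      "\<And>N'. N' \<in> grassmannian l \<Longrightarrow> \<exists>z\<in>Z. \<forall>h. norm (?P N' (foldr T z h)) \<le> norm (?P N h) + \<delta> * norm h"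
      using finite_words_rotate[OF N \<delta>(1)] by blast
    have "Z \<noteq> {}" using Z(3)[OF N] by auto
    define \<rho> where "\<rho> = Min ((\<lambda>z. ratio z) ` Z)"
    have \<rho>: "0 < \<rho>" unfolding \<rho>_def using Z \<open>Z \<noteq> {}\<close> ratio_pos by (subst Min_gr_iff) auto
    have \<rho>_le: "\<rho> \<le> ratio z" if "z \<in> Z" for z using that Z by (auto simp: \<rho>_def)
    define H where "H = E + 2 * rad"
    have H: "0 < H" using E rad_pos by (simp add: H_def)
    \<comment> \<open>Linearisation takes place at the scale of w, over displacements up to
      \<open>2 * H * ratio w\<close>, but its error must be at most s, which may be as small as
      \<open>\<rho> * R * ratio w\<close>.\<close>
    define \<omega> where "\<omega> = \<rho> * R / (2 * H)"
    have \<omega>: "0 < \<omega>" "\<omega> * (2 * H) = \<rho> * R" using \<rho> R H by (auto simp: \<omega>_def)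
    obtain \<eta> where \<eta>: "0 < \<eta>" "\<And>x p q. x \<in> K \<Longrightarrow> norm (p - x) < \<eta> \<Longrightarrow> norm (q - x) < \<eta> \<Longrightarrow>
      norm (g p - g q - g' x (p - q)) \<le> \<omega> * norm (p - q)" using uniformly_differentiable[OF \<omega>(1)] by blast
    define r0 where "r0 = \<eta> / (2 * H)"
    have r0: "0 < r0" "H * r0 < \<eta>" using \<eta>(1) H by (auto simp: r0_def)
    have "\<exists>Q s. concentrated (2 ^ n) C Q s \<and> (\<forall>x\<in>Q. cyl x \<subseteq> cyl w) \<and> \<rho> * R * ratio w \<le> s \<and> s \<le> ratio w"
      if w: "w \<in> words" "ratio w \<le> r0" for w
    proof -
      obtain a where a: "a \<in> cyl w" using cyl_nonempty by blast
      then have "a \<in> K" using cyl_subset[OF w(1)] by blast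
      obtain N1 where N1: "N1 \<in> grassmannian l" "\<And>h. g' a h = g' a (?P N1 h)" using factor[OF \<open>a \<in> K\<close>] by blast
      have lin: "linear (?P N1)" using N1(1) by (intro linear_orthogonal_projection grassmannian_subspace)
      define f where "f = inv_into UNIV (foldr T w)"
      have orth: "orthogonal_transformation (foldr T w)" using w(1) by (rule orthogonal_word)
      then have f: "orthogonal_transformation f" unfolding f_def by (rule orthogonal_transformation_inv)
      have f_T: "f (foldr T w h) = h" for h
        unfolding f_def using orthogonal_transformation_inj[OF orth] by (rule inv_f_f)
      have rot: "norm (?P N1 (foldr T w h)) = norm (?P (f ` N1) h)" for h
        using orthogonal_projection_image[OF f grassmannian_subspace[OF N1(1)], of "foldr T w h"] f
        by (simp add: f_T orthogonal_transformation)
      obtain z where z: "z \<in> Z" "\<And>h. norm (?P (f ` N1) (foldr T z h)) \<le> norm (?P N h) + \<delta> * norm h"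
        using Z(3)[OF grassmannian_image[OF f N1(1)]] by blast
      have zw: "z \<in> words" "\<rho> \<le> ratio z" "ratio z \<le> 1" using z Z \<rho>_le ratio_le_1 by auto
      have pos: "0 < ratio w" "0 < ratio z" using ratio_pos w zw by auto
      define Q where "Q = (@) (w @ z) ` W"
      define s where "s = ratio w * ratio z * R"
      have s0: "0 < s" using pos R by (simp add: s_def)
      have "ratio z * R \<le> 1" using zw pos R by (intro mult_le_one) auto
      then have s_le: "s \<le> ratio w" unfolding s_def mult.assoc using pos by (simp add: mult_left_le)
      have "\<rho> * R \<le> ratio z * R" using zw R by simp
      then have le_s: "\<rho> * R * ratio w \<le> s" unfolding s_def
        using mult_right_mono[of "\<rho> * R" "ratio z * R" "ratio w"] pos by (simp add: mult_ac)
      have Q: "disj Q" "card Q = 2 ^ n" "\<And>x. x \<in> Q \<Longrightarrow> ratio x = s"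
      proof -
        show "disj Q" unfolding Q_def using w zw W(1) by (intro disj_append) simp_all
        show "card Q = 2 ^ n" unfolding Q_def using W(2) by (subst card_image) (auto intro: inj_onI)
        show "ratio x = s" if "x \<in> Q" for x using that ratioW by (auto simp: Q_def s_def)
      qed
      have sub: "cyl x \<subseteq> cyl w" if x: "x \<in> Q" for x
      proof -
        obtain y where "y \<in> W" "x = w @ z @ y" using x by (auto simp: Q_def)
        then show ?thesis using cyl_append_subset[of "z @ y" w] zw words by simp
      qed
      have Qw: "x \<in> words" if "x \<in> Q" for x using that Q(1) by (auto simp: disj_def)
      have "dist (g p) (g q) \<le> C * s" if px: "x \<in> Q" "p \<in> near x" and qy: "y \<in> Q" "q \<in> near y" for p q x y
      proof -
        have near_a: "norm (p - a) \<le> H * ratio w" if xp: "x \<in> Q" "p \<in> near x" for x p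
        proof -
          obtain y where y: "y \<in> cyl x" "dist p y \<le> E * s"
            using xp Q(3) by (auto simp: near_def E_def)
          have "y \<in> cyl w" using y(1) sub[OF xp(1)] by blast
          then have "norm (y - a) \<le> 2 * (ratio w * rad)"
            using norm_diff_centre_le[OF w(1) a] norm_diff_centre_le[OF w(1), of y]
              dist_triangle2[of y a "centre w"] unfolding dist_norm by linarith
          moreover have "E * s \<le> E * ratio w" using s_le E by simp
          ultimately show ?thesis
            using y(2) norm_triangle_ineq[of "p - y" "y - a"] by (simp add: dist_norm H_def algebra_simps)
        qed
        have "H * ratio w < \<eta>" using r0 w(2) H by (meson le_less_trans less_imp_le mult_left_mono)
        then have "norm (g p - g q - g' a (p - q)) \<le> \<omega> * norm (p - q)"
          using near_a[OF px] near_a[OF qy] by (intro \<eta>(2) \<open>a \<in> K\<close>) auto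
        also have "\<dots> \<le> \<omega> * (2 * H * ratio w)"
          using near_a[OF px] near_a[OF qy] norm_triangle_ineq4[of "p - a" "q - a"] \<omega>(1)
          by (intro mult_left_mono) auto
        also have "\<dots> \<le> s" using le_s \<omega>(2) by (simp add: mult.assoc[symmetric])
        finally have 1: "norm (g p - g q - g' a (p - q)) \<le> s" .
        obtain x' where x': "x' \<in> W" "x = w @ z @ x'" using px by (auto simp: Q_def)
        obtain y' where y': "y' \<in> W" "y = w @ z @ y'" using qy by (auto simp: Q_def)
        have "centre x - centre y = (ratio w * ratio z) *\<^sub>R foldr T w (foldr T z (centre x' - centre y'))"
          using word_diff[of "w @ z" "centre x'" "centre y'"] w zw x' y' by simp
        then have "norm (?P N1 (centre x - centre y)) =
            ratio w * ratio z * norm (?P (f ` N1) (foldr T z (centre x' - centre y')))"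
          using pos by (simp add: linear_cmul[OF lin] rot abs_mult)
        also have "\<dots> \<le> ratio w * ratio z * (2 * R)"
        proof (rule mult_left_mono)
          have "norm (centre x' - centre y') \<le> 4 * rad"
            using norm_centre_le[OF words[OF x'(1)]] norm_centre_le[OF words[OF y'(1)]]
              norm_triangle_ineq4[of "centre x'" "centre y'"] by linarith
          then have "\<delta> * norm (centre x' - centre y') \<le> R"
            using \<delta> mult_left_mono[of "norm (centre x' - centre y')" "4 * rad" \<delta>] by linarith
          then show "norm (?P (f ` N1) (foldr T z (centre x' - centre y'))) \<le> 2 * R"
            using z(2)[of "centre x' - centre y'"] close[OF x'(1) y'(1)] by linarith
        qed (use pos in simp)
        finally have 2: "norm (?P N1 (centre x - centre y)) \<le> 2 * s" by (simp add: s_def)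
        have "norm (p - centre x) \<le> (E + rad) * s" "norm (q - centre y) \<le> (E + rad) * s"
          using norm_near_centre_le[OF Qw[OF px(1)] px(2)] norm_near_centre_le[OF Qw[OF qy(1)] qy(2)]
            Q(3)[OF px(1)] Q(3)[OF qy(1)] by (simp_all add: E_def)
        then have 3: "norm ((p - centre x) - (q - centre y)) \<le> 2 * (E + rad) * s"
          using norm_triangle_ineq4[of "p - centre x" "q - centre y"] by linarith
        have "p - q = (centre x - centre y) + ((p - centre x) - (q - centre y))" by simp
        then have "?P N1 (p - q) = ?P N1 (centre x - centre y) + ?P N1 ((p - centre x) - (q - centre y))"
          by (metis linear_add[OF lin])
        then have "norm (?P N1 (p - q)) \<le> 2 * s + 2 * (E + rad) * s"
          using 2 3 norm_orthogonal_projection_le[OF grassmannian_subspace[OF N1(1)], of "(p - centre x) - (q - centre y)"]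
            norm_triangle_ineq[of "?P N1 (centre x - centre y)" "?P N1 ((p - centre x) - (q - centre y))"] by simp
        then have 4: "norm (?P N1 (p - q)) \<le> (2 + 2 * (E + rad)) * s" by (simp add: algebra_simps)
        have "norm (g' a (p - q)) \<le> norm (g' a) * norm (?P N1 (p - q))"
          unfolding N1(2)[of "p - q"] by (rule norm_blinfun)
        also have "\<dots> \<le> L * ((2 + 2 * (E + rad)) * s)"
          using 4 L \<open>a \<in> K\<close> by (intro mult_mono) auto
        finally have "norm (g p - g q) \<le> L * ((2 + 2 * (E + rad)) * s) + s"
          using 1 norm_triangle_sub[of "g p - g q" "g' a (p - q)"] by simp
        then show ?thesis by (simp add: dist_norm C_def algebra_simps)
      qed
      then have "concentrated (2 ^ n) C Q s" unfolding concentrated_def using Q s0 by blast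
      with sub le_s s_le show ?thesis by blast
    qed
    moreover have "0 < \<rho> * R" using \<rho> R by simp
    ultimately show ?thesis using r0(1) by blast
  qed
  with C that show ?thesis by blast
qed

text \<open>Clusters are removed from \<open>K\<close> in stages. Each stage uses up a fixed proportion of the content of a
  maximal disjoint family, while the total content never exceeds 1, so at some stage little content is left.\<close>

lemma exists_concentrated_cover:
  assumes "0 < C" "0 < \<theta>" "0 < r0" "0 < \<epsilon>"
    and conc: "\<forall>w\<in>words. ratio w \<le> r0 \<longrightarrow>
      (\<exists>Q s. concentrated n C Q s \<and> (\<forall>x\<in>Q. cyl x \<subseteq> cyl w) \<and> \<theta> * ratio w \<le> s \<and> s \<le> ratio w)"
    and "0 < n"
  shows "\<exists>\<Q> F. finite \<Q> \<and> disj (\<Union>\<Q>) \<and> disjoint \<Q> \<and> (\<forall>Q\<in>\<Q>. \<exists>s\<le>r0. concentrated n C Q s) \<and>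
    disj F \<and> (\<forall>w\<in>F. ratio w \<le> r0) \<and> content F \<le> \<epsilon> \<and> K \<subseteq> (\<Union>w\<in>\<Union>\<Q> \<union> F. near w)"
proof (rule ccontr)
  let ?t = "hausdorff_dim K"
  assume no: "\<not> ?thesis"
  define state where "state \<Q> \<longleftrightarrow> finite \<Q> \<and> disj (\<Union>\<Q>) \<and> disjoint \<Q> \<and> (\<forall>Q\<in>\<Q>. \<exists>s\<le>r0. concentrated n C Q s)" for \<Q>
  \<comment> \<open>The gain per stage: a remainder of content above \<epsilon> yields clusters of
    relative size at least \<theta> inside its cylinders.\<close>
  define \<gamma> where "\<gamma> = \<theta> powr ?t * \<epsilon>"
  have \<gamma>: "0 < \<gamma>" using assms by (simp add: \<gamma>_def)
  have step: "\<exists>\<Q>'. state \<Q>' \<and> content (\<Union>\<Q>) + \<gamma> \<le> content (\<Union>\<Q>')" if st: "state \<Q>" for \<Q>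
  proof -
    have fin: "finite \<Q>" and dQ: "disj (\<Union>\<Q>)" and dis: "disjoint \<Q>" using st by (auto simp: state_def)
    have finU: "finite (\<Union>\<Q>)" and wU: "\<Union>\<Q> \<subseteq> words" using dQ by (auto simp: disj_def)
    \<comment> \<open>The new cylinders must be no larger than any used so far, as
      \<open>exists_maximal_disj\<close> requires; the entries r0 and 1/2 keep s small, also at the
      empty first stage.\<close>
    define s where "s = Min (insert (1 / 2) (insert r0 ((\<lambda>w. ratio w) ` \<Union>\<Q>)))"
    have s: "0 < s" "s \<le> r0" "s \<le> 1 / 2" and s_le: "\<And>w. w \<in> \<Union>\<Q> \<Longrightarrow> s \<le> ratio w"
    proof -
      show "0 < s" unfolding s_def using finU wU \<open>0 < r0\<close> ratio_pos by (subst Min_gr_iff) auto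
      show "s \<le> r0" "s \<le> 1 / 2" unfolding s_def using finU by (intro Min_le; simp)+
      show "s \<le> ratio w" if "w \<in> \<Union>\<Q>" for w unfolding s_def using finU that by (intro Min_le) auto
    qed
    have "s < 1" using s(3) by simp
    have "\<exists>F. disj (\<Union>\<Q> \<union> F) \<and> \<Union>\<Q> \<inter> F = {} \<and> (\<forall>w\<in>F. ratio w \<le> s) \<and> K \<subseteq> (\<Union>w\<in>\<Union>\<Q> \<union> F. near w)"
      by (rule exists_maximal_disj[OF dQ s(1) \<open>s < 1\<close> s_le])
    then obtain F where F: "disj (\<Union>\<Q> \<union> F)" "\<Union>\<Q> \<inter> F = {}" "\<And>w. w \<in> F \<Longrightarrow> ratio w \<le> s" "K \<subseteq> (\<Union>w\<in>\<Union>\<Q> \<union> F. near w)"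
      by (elim exE conjE) (simp add: Ball_def)
    have dF: "disj F" by (rule disj_subset[OF F(1)]) simp
    have rF: "\<And>w. w \<in> F \<Longrightarrow> ratio w \<le> r0" using F(3) s(2) by (rule order_trans)
    \<comment> \<open>Otherwise the clusters so far together with F would be the cover that was
      assumed not to exist.\<close>
    have big: "\<epsilon> < content F"
    proof (rule ccontr)
      assume "\<not> \<epsilon> < content F"
      then have "content F \<le> \<epsilon>" by simp
      with no st dF rF F(4) show False unfolding state_def by blast
    qed
    have finF: "finite F" and wF: "\<And>w. w \<in> F \<Longrightarrow> w \<in> words" using dF by (auto simp: disj_def)
    have "\<forall>w\<in>F. \<exists>Q s. concentrated n C Q s \<and> (\<forall>x\<in>Q. cyl x \<subseteq> cyl w) \<and> \<theta> * ratio w \<le> s \<and> s \<le> ratio w"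
      using conc wF rF by blast
    then obtain q \<sigma> where q: "\<And>w. w \<in> F \<Longrightarrow> concentrated n C (q w) (\<sigma> w)"
      and q_sub: "\<And>w x. w \<in> F \<Longrightarrow> x \<in> q w \<Longrightarrow> cyl x \<subseteq> cyl w"
      and \<sigma>: "\<And>w. w \<in> F \<Longrightarrow> \<theta> * ratio w \<le> \<sigma> w" "\<And>w. w \<in> F \<Longrightarrow> \<sigma> w \<le> ratio w" by metis
    have dq: "disj (q w)" if "w \<in> F" for w using q[OF that] by (simp add: concentrated_def)
    have cyl_disj: "cyl u \<inter> cyl w = {}" if "u \<in> \<Union>\<Q> \<union> F" "w \<in> \<Union>\<Q> \<union> F" "u \<noteq> w" for u w
      using F(1) that unfolding disj_def disjoint_family_on_def by blast
    have q_cyl: "cyl x \<inter> cyl y = {}" if "u \<in> F" "w \<in> F" "u \<noteq> w" "x \<in> q u" "y \<in> q w" for u w x y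
      using cyl_disj[of u w] that q_sub[of u x] q_sub[of w y] by blast
    have q_cyl': "cyl x \<inter> cyl y = {}" if "x \<in> \<Union>\<Q>" "w \<in> F" "y \<in> q w" for x w y
    proof -
      have "x \<noteq> w" using that F(2) by blast
      then show ?thesis using cyl_disj[of x w] that q_sub[of w y] by blast
    qed
    have q_disjoint: "q u \<inter> q w = {}" if "u \<in> F" "w \<in> F" "u \<noteq> w" for u w
      using q_cyl[OF that] cyl_nonempty by (metis Int_absorb disjoint_iff)
    have q_disjoint': "Q \<inter> q w = {}" if "Q \<in> \<Q>" "w \<in> F" for Q w
      using q_cyl'[OF _ that(2)] that(1) cyl_nonempty by (metis Int_absorb UnionI disjoint_iff)
    have dqF: "disj (\<Union>w\<in>F. q w)"
      unfolding disj_def disjoint_family_on_def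
    proof (intro conjI ballI impI)
      show "finite (\<Union>w\<in>F. q w)" "(\<Union>w\<in>F. q w) \<subseteq> words" using finF dq by (auto simp: disj_def)
      fix x y assume "x \<in> (\<Union>w\<in>F. q w)" "y \<in> (\<Union>w\<in>F. q w)" "x \<noteq> y"
      then obtain u w where uw: "u \<in> F" "w \<in> F" "x \<in> q u" "y \<in> q w" by blast
      show "cyl x \<inter> cyl y = {}"
      proof (cases "u = w")
        case True
        then show ?thesis using dq[OF uw(1)] uw \<open>x \<noteq> y\<close> unfolding disj_def disjoint_family_on_def by blast
      qed (use q_cyl uw in blast)
    qed
    define \<Q>' where "\<Q>' = \<Q> \<union> q ` F"
    have U': "\<Union>\<Q>' = \<Union>\<Q> \<union> (\<Union>w\<in>F. q w)" by (auto simp: \<Q>'_def)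
    have un: "disj (\<Union>\<Q>')" "\<Union>\<Q> \<inter> (\<Union>w\<in>F. q w) = {}"
    proof -
      have cross: "cyl x \<inter> cyl y = {}" if x: "x \<in> \<Union>\<Q>" and y: "y \<in> (\<Union>w\<in>F. q w)" for x y
        using y by (rule UN_E) (rule q_cyl'[OF x])
      show "disj (\<Union>\<Q>')" "\<Union>\<Q> \<inter> (\<Union>w\<in>F. q w) = {}"
        unfolding U' by (rule disj_Un[OF dQ dqF cross], assumption+)+
    qed
    have "disjoint \<Q>'"
      unfolding \<Q>'_def
    proof (rule disjoint_union[OF dis])
      show "disjoint (q ` F)" unfolding disjoint_def using q_disjoint by blast
      show "\<Union>\<Q> \<inter> \<Union>(q ` F) = {}" using un(2) by simp
    qed
    moreover have "\<exists>s\<le>r0. concentrated n C Q s" if "Q \<in> \<Q>'" for Q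
      using that st q \<sigma>(2) rF order_trans unfolding \<Q>'_def state_def by blast
    ultimately have "state \<Q>'" unfolding state_def using un(1) fin finF by (simp add: \<Q>'_def)
    moreover have "content (\<Union>\<Q>) + \<gamma> \<le> content (\<Union>\<Q>')"
    proof -
      have "\<theta> powr ?t * ratio w powr ?t \<le> content (q w)" if w: "w \<in> F" for w
      proof -
        have "\<theta> powr ?t * ratio w powr ?t = (\<theta> * ratio w) powr ?t"
          using \<open>0 < \<theta>\<close> ratio_pos[OF wF[OF w]] by (simp add: powr_mult)
        also have "\<dots> \<le> \<sigma> w powr ?t"
          using \<sigma>(1)[OF w] \<open>0 < \<theta>\<close> ratio_pos[OF wF[OF w]] hausdorff_dim_nonneg by (intro powr_mono2) auto
        \<comment> \<open>Counting one cylinder of each cluster is enough for a fixed gain.\<close>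
        also have "\<dots> \<le> real n * \<sigma> w powr ?t" using \<open>0 < n\<close> by (simp add: mult_le_cancel_right1)
        also have "\<dots> = content (q w)" using q[OF w] by (simp add: concentrated_def)
        finally show ?thesis .
      qed
      then have "\<theta> powr ?t * content F \<le> (\<Sum>w\<in>F. content (q w))"
        unfolding sum_distrib_left by (rule sum_mono)
      also have "\<dots> = content (\<Union>w\<in>F. q w)"
        using finF dq q_disjoint by (intro sum.UNION_disjoint[symmetric]) (auto simp: disj_def)
      finally have "\<theta> powr ?t * content F \<le> content (\<Union>w\<in>F. q w)" .
      moreover have "\<gamma> \<le> \<theta> powr ?t * content F" unfolding \<gamma>_def using big by (intro mult_left_mono) auto
      moreover have "content (\<Union>\<Q>') = content (\<Union>\<Q>) + content (\<Union>w\<in>F. q w)"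
        unfolding U' using finU dqF un(2) by (intro sum.union_disjoint) (auto simp: disj_def)
      ultimately show ?thesis by simp
    qed
    ultimately show ?thesis by blast
  qed
  have "\<exists>\<Q>. state \<Q> \<and> real k * \<gamma> \<le> content (\<Union>\<Q>)" for k
  proof (induction k)
    case 0
    have "state {}" by (simp add: state_def disj_def disjoint_family_on_def)
    then show ?case by (intro exI[of _ "{}"]) simp
  next
    case (Suc k)
    then obtain \<Q> where "state \<Q>" "real k * \<gamma> \<le> content (\<Union>\<Q>)" by blast
    then show ?case using step[of \<Q>] by (force simp: algebra_simps)
  qed
  moreover obtain k :: nat where "1 < real k * \<gamma>" using reals_Archimedean3[OF \<gamma>] by blast
  ultimately obtain \<Q> where "state \<Q>" "1 < content (\<Union>\<Q>)" by (meson less_le_trans)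
  then show False using disjoint_cyl_content_le_1[of "\<Union>\<Q>"] by (simp add: state_def)
qed

text \<open>Half of \<epsilon> pays for the clusters and half for the remainder. Since C does not
  depend on n, n can be chosen from C and \<epsilon>; the scale r0 follows, and the remainder is
  made small in terms of B.\<close>

lemma hausdorff_measure_image_eq_0: "hausdorff_measure (hausdorff_dim K) (g ` K) = 0"
proof (rule hausdorff_measure_eq_0I[where 'i = "'i list set + 'i list"])
  let ?t = "hausdorff_dim K"
  show "0 < ?t" by (rule hausdorff_dim_pos)
  fix \<delta> \<epsilon> :: real assume pos: "0 < \<delta>" "0 < \<epsilon>"
  obtain C where C: "0 < C" "\<And>n. \<exists>\<theta>>0. \<exists>r0>0. \<forall>w\<in>words. ratio w \<le> r0 \<longrightarrow>
    (\<exists>Q s. concentrated (2 ^ n) C Q s \<and> (\<forall>x\<in>Q. cyl x \<subseteq> cyl w) \<and> \<theta> * ratio w \<le> s \<and> s \<le> ratio w)"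
    using exists_concentrated by blast
  obtain B r1 where B: "0 < B" "0 < r1" "\<And>w p q. w \<in> words \<Longrightarrow> ratio w \<le> r1 \<Longrightarrow> p \<in> near w \<Longrightarrow> q \<in> near w \<Longrightarrow>
    dist (g p) (g q) \<le> B * ratio w" using dist_image_near_le by blast
  obtain n where "2 * C powr ?t / \<epsilon> < 2 ^ n" using real_arch_pow[of 2] by auto
  then have n: "C powr ?t / 2 ^ n \<le> \<epsilon> / 2" using pos by (simp add: field_simps)
  obtain \<theta> r2 where r2: "0 < \<theta>" "0 < r2" "\<And>w. w \<in> words \<Longrightarrow> ratio w \<le> r2 \<Longrightarrow>
    \<exists>Q s. concentrated (2 ^ n) C Q s \<and> (\<forall>x\<in>Q. cyl x \<subseteq> cyl w) \<and> \<theta> * ratio w \<le> s \<and> s \<le> ratio w"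
    using C(2)[of n] by blast
  define r0 where "r0 = min (min r1 r2) (min (\<delta> / B) (\<delta> / C))"
  have r0: "0 < r0" "r0 \<le> r1" "r0 \<le> r2" "r0 \<le> \<delta> / B" "r0 \<le> \<delta> / C"
    using B(1,2) C(1) r2(2) pos by (auto simp: r0_def)
  then have r0': "B * r0 \<le> \<delta>" "C * r0 \<le> \<delta>" using B(1) C(1) by (simp_all add: field_simps)
  have e: "0 < \<epsilon> / (2 * B powr ?t)" using pos B by simp
  have conc: "\<forall>w\<in>words. ratio w \<le> r0 \<longrightarrow>
    (\<exists>Q s. concentrated (2 ^ n) C Q s \<and> (\<forall>x\<in>Q. cyl x \<subseteq> cyl w) \<and> \<theta> * ratio w \<le> s \<and> s \<le> ratio w)"
    by (intro ballI impI r2(3) order_trans[OF _ r0(3)])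
  have "0 < (2::nat) ^ n" by simp
  from exists_concentrated_cover[OF C(1) r2(1) r0(1) e conc this]
  obtain \<Q> F where \<Q>: "finite \<Q>" "disj (\<Union>\<Q>)" "disjoint \<Q>" "\<forall>Q\<in>\<Q>. \<exists>s\<le>r0. concentrated (2 ^ n) C Q s"
    and F: "disj F" "\<forall>w\<in>F. ratio w \<le> r0" "content F \<le> \<epsilon> / (2 * B powr ?t)"
    and cover: "K \<subseteq> (\<Union>w\<in>\<Union>\<Q> \<union> F. near w)"
    by (elim exE conjE) (rule that)
  obtain s where s: "\<And>Q. Q \<in> \<Q> \<Longrightarrow> s Q \<le> r0" "\<And>Q. Q \<in> \<Q> \<Longrightarrow> concentrated (2 ^ n) C Q (s Q)"
    using bchoice[OF \<Q>(4)] by blast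
  have s0: "\<And>Q. Q \<in> \<Q> \<Longrightarrow> 0 < s Q" using s(2) by (simp add: concentrated_def)
  have wF: "finite F" "\<And>w. w \<in> F \<Longrightarrow> w \<in> words" using F by (auto simp: disj_def)
  define V where "V i = (case i of Inl Q \<Rightarrow> g ` (\<Union>w\<in>Q. near w) | Inr w \<Rightarrow> g ` near w)" for i
  define b where "b i = (case i of Inl Q \<Rightarrow> C * s Q | Inr w \<Rightarrow> B * ratio w)" for i
  have "g ` K \<subseteq> (\<Union>i\<in>\<Q> <+> F. V i)"
  proof
    fix y assume "y \<in> g ` K"
    then obtain x where x: "x \<in> K" "y = g x" by blast
    have "x \<in> (\<Union>w\<in>\<Union>\<Q> \<union> F. near w)" by (rule subsetD[OF cover x(1)])
    then obtain w where "w \<in> \<Union>\<Q> \<union> F" "x \<in> near w" by (rule UN_E)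
    then consider Q where "Q \<in> \<Q>" "w \<in> Q" "x \<in> near w" | "w \<in> F" "x \<in> near w" by blast
    then show "y \<in> (\<Union>i\<in>\<Q> <+> F. V i)"
    proof cases
      case 1
      then have "y \<in> V (Inl Q)" using x(2) by (auto simp: V_def)
      with 1(1) show ?thesis by blast
    next
      case 2
      then have "y \<in> V (Inr w)" using x(2) by (auto simp: V_def)
      with 2(1) show ?thesis by blast
    qed
  qed
  moreover have "0 \<le> b i \<and> b i \<le> \<delta> \<and> (\<forall>x\<in>V i. \<forall>y\<in>V i. dist x y \<le> b i)" if i: "i \<in> \<Q> <+> F" for i
  proof (cases i)
    case (Inl Q)
    then have Q: "Q \<in> \<Q>" using i by blast
    have "C * s Q \<le> C * r0" using s(1)[OF Q] C(1) by (intro mult_left_mono) auto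
    then have "0 \<le> C * s Q" "C * s Q \<le> \<delta>"
      using mult_pos_pos[OF C(1) s0[OF Q]] r0'(2) by linarith+
    moreover have "dist (g p) (g q) \<le> C * s Q" if "p \<in> (\<Union>w\<in>Q. near w)" "q \<in> (\<Union>w\<in>Q. near w)" for p q
      using s(2)[OF Q] that unfolding concentrated_def by blast
    ultimately show ?thesis by (auto simp: Inl b_def V_def)
  next
    case (Inr w)
    then have w: "w \<in> F" using i by blast
    have "B * ratio w \<le> B * r0" using F(2) w B(1) by (intro mult_left_mono) auto
    then have "0 \<le> B * ratio w" "B * ratio w \<le> \<delta>"
      using mult_pos_pos[OF B(1) ratio_pos[OF wF(2)[OF w]]] r0'(1) by linarith+
    moreover have "dist (g p) (g q) \<le> B * ratio w" if "p \<in> near w" "q \<in> near w" for p q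
      using B(3)[OF wF(2)[rule_format, OF w] order_trans[OF F(2)[rule_format, OF w] r0(2)] that] .
    ultimately show ?thesis by (auto simp: Inr b_def V_def)
  qed
  moreover have "(\<Sum>i\<in>\<Q> <+> F. b i powr ?t) \<le> \<epsilon>"
  proof -
    have "(\<Sum>Q\<in>\<Q>. (C * s Q) powr ?t) = (\<Sum>Q\<in>\<Q>. C powr ?t / 2 ^ n * content Q)"
    proof (rule sum.cong[OF refl])
      fix Q assume Q: "Q \<in> \<Q>"
      have "content Q = 2 ^ n * s Q powr ?t" using s(2)[OF Q] by (simp add: concentrated_def)
      then show "(C * s Q) powr ?t = C powr ?t / 2 ^ n * content Q"
        using C(1) s0[OF Q] by (simp add: powr_mult)
    qed
    \<comment> \<open>The clusters share no words, so their contents add up to that of one disjoint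
      family, which is at most 1.\<close>
    also have "\<dots> = C powr ?t / 2 ^ n * content (\<Union>\<Q>)"
      unfolding sum_distrib_left[symmetric]
      using \<Q>(3) s(2) by (subst sum.Union_disjoint) (auto simp: concentrated_def disj_def disjoint_def)
    also have "\<dots> \<le> C powr ?t / 2 ^ n * 1"
      using disjoint_cyl_content_le_1[OF \<Q>(2)] by (intro mult_left_mono) auto
    finally have 1: "(\<Sum>Q\<in>\<Q>. (C * s Q) powr ?t) \<le> \<epsilon> / 2"
      using n unfolding mult_1_right by (rule order_trans)
    have "(\<Sum>w\<in>F. (B * ratio w) powr ?t) = B powr ?t * content F"
      unfolding sum_distrib_left using B(1) ratio_pos wF(2) by (intro sum.cong) (auto simp: powr_mult less_imp_le)
    also have "\<dots> \<le> B powr ?t * (\<epsilon> / (2 * B powr ?t))" using F(3) by (intro mult_left_mono) auto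
    also have "\<dots> = \<epsilon> / 2" using B(1) by simp
    finally have 2: "(\<Sum>w\<in>F. (B * ratio w) powr ?t) \<le> \<epsilon> / 2" .
    show ?thesis using 1 2 \<Q>(1) wF(1) by (simp add: sum.Plus b_def)
  qed
  ultimately show "\<exists>(I::('i list set + 'i list) set) V b. finite I \<and> g ` K \<subseteq> (\<Union>i\<in>I. V i) \<and>
      (\<forall>i\<in>I. 0 \<le> b i \<and> b i \<le> \<delta> \<and> (\<forall>x\<in>V i. \<forall>y\<in>V i. dist x y \<le> b i)) \<and> (\<Sum>i\<in>I. b i powr ?t) \<le> \<epsilon>"
    using \<Q>(1) wF(1) by (intro exI[of _ "\<Q> <+> F"] exI[of _ V] exI[of _ b]) (simp add: finite_Plus)
qed

end

text \<open>Enlarging a subspace becomes shrinking one under orthogonal complements: N is the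
  complement of a subspace of dimension d - l chosen inside the complement of A.\<close>

lemma exists_grassmannian_superset:
  fixes A :: "'a::euclidean_space set"
  assumes "dim A \<le> l" "l \<le> DIM('a)"
  shows "\<exists>N\<in>grassmannian l. A \<subseteq> N"
proof -
  define D where "D = {y \<in> UNIV. \<forall>x\<in>span A. orthogonal x y}"
  have D: "subspace D" unfolding D_def using subspace_orthogonal_to_vectors[of "span A"] by simp
  have "dim D + dim (span A) = dim (UNIV :: 'a set)"
    unfolding D_def by (intro dim_subspace_orthogonal_to_vectors) auto
  then have "DIM('a) - l \<le> dim D" using assms(1) by simp
  then obtain B where B: "subspace B" "B \<subseteq> span D" "dim B = DIM('a) - l"
    by (rule choose_subspace_of_subspace)
  define N where "N = {y \<in> UNIV. \<forall>x\<in>B. orthogonal x y}"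
  have "subspace N" unfolding N_def using subspace_orthogonal_to_vectors[of B] by simp
  moreover have "dim N + dim B = dim (UNIV :: 'a set)"
    unfolding N_def using B(1) by (intro dim_subspace_orthogonal_to_vectors) auto
  then have "dim N = l" using B(3) assms(2) by simp
  moreover have "B \<subseteq> D" using B(2) span_minimal[OF order_refl D] by (rule order_trans)
  then have "orthogonal y x" if "x \<in> A" "y \<in> B" for x y
    using that span_base[of x A] by (auto simp: D_def orthogonal_commute)
  then have "A \<subseteq> N" by (auto simp: N_def)
  ultimately show ?thesis by (auto simp: grassmannian_def)
qed

text \<open>A vector orthogonal to all rows lies in the kernel. The row space may have dimension
  below l, so N is an l-plane containing it.\<close>

lemma rank_le_factor_projection:
  fixes A :: "real ^ 'd \<Rightarrow> real ^ 'e"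
  assumes "linear A" "rank (matrix A) \<le> l" "l \<le> CARD('d)"
  shows "\<exists>N\<in>grassmannian l. \<forall>h. A h = A (orthogonal_projection N h)"
proof -
  have "dim (rows (matrix A)) \<le> l" using assms(2) by (simp add: row_rank_def)
  then obtain N where N: "N \<in> grassmannian l" "rows (matrix A) \<subseteq> N"
    using exists_grassmannian_superset[of "rows (matrix A)" l] assms(3) by auto
  have "A h = A (orthogonal_projection N h)" for h
  proof -
    let ?d = "h - orthogonal_projection N h"
    have "orthogonal ?d z" if "z \<in> N" for z
      using orthogonal_projection(2)[OF _ that] N(1) by (simp add: grassmannian_def)
    then have "row i (matrix A) \<bullet> ?d = 0" for i
      using N(2) by (force simp: rows_def orthogonal_def inner_commute)
    then have "matrix A *v ?d = 0"
      by (simp add: vec_eq_iff matrix_vector_mul_component row_def)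
    then have "A ?d = 0" using assms(1) by (simp add: matrix_works linear_matrix_vector_mul_eq)
    then show ?thesis using linear_diff[OF assms(1)] by simp
  qed
  with N(1) show ?thesis by blast
qed

theorem theorem1p5:
  fixes m l :: nat
    and S T :: "nat \<Rightarrow> real ^ 'd \<Rightarrow> real ^ 'd"
    and r :: "nat \<Rightarrow> real"
    and v :: "nat \<Rightarrow> real ^ 'd"
    and K U M :: "(real ^ 'd) set"
    and g :: "real ^ 'd \<Rightarrow> real ^ 'e"
    and g' :: "real ^ 'd \<Rightarrow> (real ^ 'd) \<Rightarrow>\<^sub>L (real ^ 'e)"
  assumes "ss_ifs m S r T v"
    and "ifs_attractor m S K"
    and "\<exists>x\<in>K. \<exists>y\<in>K. x \<noteq> y"
    and "open U" and "K \<subseteq> U"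
    and "1 \<le> l" and "l < CARD('d)"
    and "M \<in> grassmannian l"
    and "grassmann_topology l closure_of {f ` M | f. f \<in> transformation_group m T} = grassmannian l"
    and "\<And>x. x \<in> U \<Longrightarrow> (g has_derivative blinfun_apply (g' x)) (at x)"
    and "continuous_on U g'"
    and "\<And>x. x \<in> K \<Longrightarrow> rank (matrix (blinfun_apply (g' x))) \<le> l"
  shows "hausdorff_measure (hausdorff_dim K) (g ` K) = 0"
proof -
  interpret dense_self_similar_map "{1..m}" S T r v K l M U g g'
  proof
    show "l < DIM(real ^ 'd)" using assms(7) by simp
    show "grassmann_topology l closure_of {f ` M | f. f \<in> generate (BijGroup UNIV) (T ` {1..m})} = grassmannian l"
      using assms(9) by (simp only: transformation_group_def)
    show "\<exists>N\<in>grassmannian l. \<forall>h. g' x h = g' x (orthogonal_projection N h)" if "x \<in> K" for x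
      using assms(7) assms(12)[OF that]
      by (intro rank_le_factor_projection) (auto simp: blinfun.bounded_linear_right bounded_linear.linear)
    show "K = (\<Union>i\<in>{1..m}. S i ` K)" "compact K"
      using assms(2) unfolding ifs_attractor_def by blast+
    show "0 < r i" "r i < 1" "orthogonal_transformation (T i)" "S i x = r i *\<^sub>R T i x + v i" if "i \<in> {1..m}" for i x
      using assms(1) that unfolding ss_ifs_def by blast+
  qed (fact assms | simp)+
  show ?thesis by (rule hausdorff_measure_image_eq_0)
qed

end
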